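(* Let $H=\left(\bigcup_{i\in I_1}P_{2\ell_i}\right)\cup\left(\bigcup_{j\in I_2}P_{2\ell_j+1}\right)$ be a linear forest with $|I_1\cup I_2|=k\geq 2$ components, where $\ell_i\geq 2$ for $i\in I_1$ and $\ell_j\geq 1$ for $j\in I_2$, let $\ell=\sum_{i=1}^k\ell_i$ and assume $H\neq kP_3$. Let $F$ be a graph without isolated vertices with $\chi(F)\geq 3$ and $\beta_1(F)=1$. Then there is $N=N(H,F)$ such that for all $n\geq N$, $$ex(n,\{H,F\})=(\ell-1)(n-\ell+1)+D_{F,H},$$ where $D_{F,H}=0$ if the pair $(F,H)$ has property $\mathscr{R}$ and $D_{F,H}=1$ otherwise.
   Context: All graphs are finite and simple. $ex(n,\mathscr{F})$ is the maximum number of edges of an $n$-vertex graph containing no member of $\mathscr{F}$ as a subgraph. $P_m$ is the path on $m$ vertices; the components of $H$ are vertex-disjoint paths, $I_1$ indexing even paths and $I_2$ odd paths. $\chi$ is the chromatic number. An edge control set of $F$ is a set $E'\subseteq E(F)$ such that every edge not in $E'$ shares an endpoint with some edge of $E'$; $\beta_1(F)$ is its minimum size. When $\beta_1(F)=1$ with edge control set $\{u_1u_2\}$, $f(F)=\min\{d_F(u_1),d_F(u_2)\}$. $N(F,K_3)$ is the number of triangles in $F$. The pair $(F,H)$ has property $\mathscr{R}$ if at least one of: (1) $I_1\neq\emptyset$; (2) $v(F)\leq \ell+1$; (3) $N(F,K_3)=1$ and $f(F)\leq \ell$. *)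

theory Defs
  imports Main
begin

type_synonym ugraph = "nat set \<times> nat set set"

definition verts :: "ugraph \<Rightarrow> nat set" where "verts G = fst G"
definition edges :: "ugraph \<Rightarrow> nat set set" where "edges G = snd G"

definition wf_graph :: "ugraph \<Rightarrow> bool" where
  "wf_graph G \<longleftrightarrow> finite (verts G) \<and>
     (\<forall>e\<in>edges G. \<exists>u v. u \<noteq> v \<and> u \<in> verts G \<and> v \<in> verts G \<and> e = {u, v})"

definition contains :: "ugraph \<Rightarrow> ugraph \<Rightarrow> bool" where
  "contains G F \<longleftrightarrow> (\<exists>f. inj_on f (verts F) \<and> f ` verts F \<subseteq> verts G \<and>
                          (\<forall>e\<in>edges F. f ` e \<in> edges G))"

text \<open>Turan number ex(n, Fs): every n-vertex graph is isomorphic to one on {0..<n}.\<close>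
definition ex :: "nat \<Rightarrow> ugraph set \<Rightarrow> nat" where
  "ex n Fs = Max {card (edges G) | G. wf_graph G \<and> verts G = {0..<n} \<and>
                                      (\<forall>F\<in>Fs. \<not> contains G F)}"

definition degree :: "ugraph \<Rightarrow> nat \<Rightarrow> nat" where
  "degree G v = card {e \<in> edges G. v \<in> e}"

definition no_isolated :: "ugraph \<Rightarrow> bool" where
  "no_isolated G \<longleftrightarrow> (\<forall>v\<in>verts G. \<exists>e\<in>edges G. v \<in> e)"

definition colorable :: "ugraph \<Rightarrow> nat \<Rightarrow> bool" where
  "colorable G c \<longleftrightarrow> (\<exists>col :: nat \<Rightarrow> nat. (\<forall>v\<in>verts G. col v < c) \<and>
       (\<forall>u v. {u, v} \<in> edges G \<longrightarrow> col u \<noteq> col v))"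

definition chromatic_number :: "ugraph \<Rightarrow> nat" where
  "chromatic_number G = (LEAST c. colorable G c)"

definition edge_control_set :: "ugraph \<Rightarrow> nat set set \<Rightarrow> bool" where
  "edge_control_set G E' \<longleftrightarrow> E' \<subseteq> edges G \<and>
     (\<forall>e \<in> edges G - E'. \<exists>e'\<in>E'. e \<inter> e' \<noteq> {})"

definition beta1 :: "ugraph \<Rightarrow> nat" where
  "beta1 G = (LEAST m. \<exists>E'. edge_control_set G E' \<and> card E' = m)"

text \<open>f(F) = min(d(u1), d(u2)) for an edge control set {u1u2}; taken as the minimum over
all single-edge control sets (for the graphs concerned all such choices give the same value).\<close>
definition f_val :: "ugraph \<Rightarrow> nat" where
  "f_val G = Min {min (degree G u1) (degree G u2) | u1 u2.
                    u1 \<noteq> u2 \<and> edge_control_set G {{u1, u2}}}"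

definition num_triangles :: "ugraph \<Rightarrow> nat" where
  "num_triangles G = card {T. \<exists>a b c. T = {a, b, c} \<and> a \<noteq> b \<and> a \<noteq> c \<and> b \<noteq> c \<and>
        {a, b} \<in> edges G \<and> {a, c} \<in> edges G \<and> {b, c} \<in> edges G}"

definition path_forest :: "nat list \<Rightarrow> ugraph" where
  "path_forest ms = ({0..<sum_list ms},
     {{sum_list (take i ms) + t, sum_list (take i ms) + t + 1} | i t.
        i < length ms \<and> t + 1 < ms ! i})"

end

theory Submission
  imports Defs
begin

text \<open>
  Write L for the sum of the numbers m div 2 over the orders m of the paths of H. In a graph without H
  that has nearly (L - 1) n edges, deleting a copy of the shortest path of H and comparing with the
  bound for the remaining forest (Erdos-Gallai and induction) shows that every such copy contains
  m div 2 vertices of linear degree. Deleting end vertices of longest paths from the remaining part of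
  the graph then forces L - 1 vertices of linear degree with many common neighbours; call this set A.

  Since F consists of edges meeting one fixed edge, A is independent. The vertices of A leave room for
  almost all of H, so that no path of order m of H may use fewer than m div 2 vertices of A. This makes
  the components outside A so poor that each missing edge to A outweighs the edges they contain, with
  one exception: if all paths are odd, a single edge whose ends are both joined to all of A. Property R
  is exactly the condition under which such an edge creates a copy of F.
\<close>

section \<open>Edge counts, paths and longest paths\<close>

text \<open>Edge counts are compared as rates per vertex, doubled to stay within the naturals. The
  target rate is L - 1, but for a single odd path Erdos-Gallai only gives m div 2 - 1/2, which
  disjoint cliques attain. The induction over the forest therefore carries the rate L - 1/2. This
  overshoots the target, yet once one path is split off, the half edge gained on the remaining
  forest pays for all losses: a copy of the shortest path with at most m div 2 - 1 vertices of
  linear degree would force a rate of at most (m div 2 - 1) + 1/4 + (L - m div 2 - 1/2) = L - 5/4.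
  Likewise, if apart from boundedly many exceptions no vertex had L - 1 neighbours of linear degree,
  the rate would drop to L - 3/2. The shortest path is chosen because k \<ge> 2 then gives 2 (m div
  2) \<le> L: if that path is missing outside the core, longest paths there are so short that their
  ends have degree below L. These arguments lose additive constants and only locate the core
  \<open>A\<close>. The exact value comes from a second deletion argument around \<open>A\<close>,
  which loses nothing.\<close>

definition nbrs :: "'a set set \<Rightarrow> 'a set \<Rightarrow> 'a \<Rightarrow> 'a set" where
  "nbrs E Y v = {u \<in> Y. {v, u} \<in> E}"

definition esize :: "'a set set \<Rightarrow> 'a set \<Rightarrow> nat" where
  "esize E X = card {e \<in> E. e \<subseteq> X}"

definition is_path :: "'a set set \<Rightarrow> 'a list \<Rightarrow> bool" where
  "is_path E p \<longleftrightarrow> distinct p \<and> successively (\<lambda>u v. {u, v} \<in> E) p"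

text \<open>Disjointness is encoded by removing each path from the available vertices, so induction
  on the list of orders deletes one component at a time.\<close>

fun has_forest :: "'a set set \<Rightarrow> 'a set \<Rightarrow> nat list \<Rightarrow> bool" where
  "has_forest E X [] \<longleftrightarrow> True"
| "has_forest E X (m # ms) \<longleftrightarrow>
     (\<exists>p. is_path E p \<and> set p \<subseteq> X \<and> length p = m \<and> has_forest E (X - set p) ms)"

text \<open>No vertex set is fixed: passing to an induced subgraph only changes the argument
  \<open>X\<close> of \<open>esize\<close> and \<open>nbrs\<close>, while \<open>E\<close> survives
  all deletions unchanged.\<close>

locale sgraph =
  fixes E :: "'a set set"
  assumes edgeE: "e \<in> E \<Longrightarrow> \<exists>u v. u \<noteq> v \<and> e = {u, v}"

lemma nbrs_subset: "nbrs E Y v \<subseteq> Y"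
  by (auto simp: nbrs_def)

lemma finite_nbrs [simp]: "finite Y \<Longrightarrow> finite (nbrs E Y v)"
  by (simp add: nbrs_def)

lemma card_nbrs_le: "finite Y \<Longrightarrow> card (nbrs E Y v) \<le> card Y"
  by (simp add: card_mono nbrs_subset)

lemma nbrs_mono: "Y \<subseteq> Z \<Longrightarrow> nbrs E Y v \<subseteq> nbrs E Z v"
  by (auto simp: nbrs_def)

context sgraph
begin

lemma no_loop [simp]: "{v} \<notin> E" "{v, v} \<notin> E"
  using edgeE by (metis doubleton_eq_iff insert_absorb2)+

lemma nbrs_Diff_self: "nbrs E (Y - {v}) v = nbrs E Y v"
  by (auto simp: nbrs_def)

lemma esize_insert:
  assumes "finite X" "v \<notin> X"
  shows "esize E (insert v X) = esize E X + card (nbrs E X v)"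
proof -
  have "{e \<in> E. e \<subseteq> insert v X} = {e \<in> E. e \<subseteq> X} \<union> (\<lambda>u. {v, u}) ` nbrs E X v" (is "?L = ?R")
  proof
    show "?L \<subseteq> ?R"
    proof
      fix e assume e: "e \<in> ?L"
      then obtain x y where "x \<noteq> y" "e = {x, y}" using edgeE by blast
      with e show "e \<in> ?R"
        by (cases "v \<in> e") (auto simp: nbrs_def insert_commute image_iff)
    qed
  qed (auto simp: nbrs_def)
  moreover have "finite {e \<in> E. e \<subseteq> X}"
    using assms(1) by (metis (no_types, lifting) finite_Pow_iff finite_subset mem_Collect_eq Pow_iff subsetI)
  moreover have "inj_on (\<lambda>u. {v, u}) (nbrs E X v)"
    by (auto simp: inj_on_def doubleton_eq_iff)
  moreover have "{e \<in> E. e \<subseteq> X} \<inter> (\<lambda>u. {v, u}) ` nbrs E X v = {}"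
    using assms by auto
  ultimately show ?thesis
    unfolding esize_def using assms by (simp add: card_Un_disjoint card_image)
qed

lemma esize_empty [simp]: "esize E {} = 0"
  using edgeE by (auto simp: esize_def)

lemma esize_remove:
  assumes "finite X" "v \<in> X"
  shows "esize E X = esize E (X - {v}) + card (nbrs E X v)"
  using esize_insert[of "X - {v}" v] assms by (simp add: insert_absorb nbrs_Diff_self)

lemma sum_nbrs_insert:
  assumes "finite X" "finite Y" "v \<notin> Y"
  shows "(\<Sum>u\<in>X. card (nbrs E (insert v Y) u)) = (\<Sum>u\<in>X. card (nbrs E Y u)) + card (nbrs E X v)"
proof -
  have "card (nbrs E (insert v Y) u) = card (nbrs E Y u) + (if {v, u} \<in> E then 1 else 0)" for u
  proof (cases "{v, u} \<in> E")
    case True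
    then have "nbrs E (insert v Y) u = insert v (nbrs E Y u)"
      by (auto simp: nbrs_def insert_commute)
    moreover have "v \<notin> nbrs E Y u" using assms by (auto simp: nbrs_def)
    ultimately show ?thesis using True assms by simp
  next
    case False
    then have "nbrs E (insert v Y) u = nbrs E Y u"
      by (auto simp: nbrs_def insert_commute)
    with False show ?thesis by simp
  qed
  moreover have "(\<Sum>u\<in>X. if {v, u} \<in> E then 1 else 0) = card (nbrs E X v)"
    using assms by (simp add: nbrs_def sum.If_cases Int_def)
  ultimately show ?thesis by (simp add: sum.distrib)
qed

lemma handshake:
  assumes "finite X"
  shows "(\<Sum>v\<in>X. card (nbrs E X v)) = 2 * esize E X"
  using assms
proof (induction X)
  case (insert v X)
  have "nbrs E (insert v X) v = nbrs E X v" by (auto simp: nbrs_def)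
  with insert show ?case
    by (simp add: esize_insert sum_nbrs_insert)
qed simp

lemma esize_Un:
  assumes "finite X" "finite Y" "X \<inter> Y = {}"
  shows "esize E (X \<union> Y) = esize E X + esize E Y + (\<Sum>v\<in>X. card (nbrs E Y v))"
  using assms(2,3)
proof (induction Y)
  case empty
  then show ?case by (simp add: nbrs_def)
next
  case (insert y Y)
  have "nbrs E (X \<union> Y) y = nbrs E X y \<union> nbrs E Y y" by (auto simp: nbrs_def)
  moreover have "card (nbrs E X y \<union> nbrs E Y y) = card (nbrs E X y) + card (nbrs E Y y)"
    using insert assms(1) by (intro card_Un_disjoint) (auto simp: nbrs_def)
  ultimately show ?case
    using insert assms(1) by (simp add: esize_insert sum_nbrs_insert)
qed

lemma esize_split:
  assumes "finite X" "Y \<subseteq> X"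
  shows "esize E X = esize E (X - Y) + esize E Y + (\<Sum>v\<in>X - Y. card (nbrs E Y v))"
proof -
  have "X = (X - Y) \<union> Y" "finite Y" using assms by (auto intro: finite_subset)
  with assms show ?thesis using esize_Un[of "X - Y" Y] by auto
qed

lemma esize_split':
  assumes "finite X" "Y \<subseteq> X"
  shows "esize E X = esize E (X - Y) + esize E Y + (\<Sum>v\<in>Y. card (nbrs E (X - Y) v))"
proof -
  have "X - (X - Y) = Y" using assms by auto
  with esize_split[OF assms(1), of "X - Y"] show ?thesis by auto
qed

lemma esize_bound:
  assumes "finite X"
  shows "2 * esize E X + card X \<le> card X * card X"
proof -
  have "card (nbrs E X v) + 1 \<le> card X" if "v \<in> X" for v
  proof -
    have "v \<notin> nbrs E X v" by (simp add: nbrs_def)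
    then have "nbrs E X v \<subset> X" using that nbrs_subset[of E X v] by blast
    from psubset_card_mono[OF assms this] show ?thesis by simp
  qed
  then have "(\<Sum>v\<in>X. card (nbrs E X v) + 1) \<le> card X * card X"
    using sum_bounded_above[of X "\<lambda>v. card (nbrs E X v) + 1" "card X"] by simp
  then show ?thesis unfolding sum.distrib handshake[OF assms] by simp
qed

lemma esize_remove_closed:
  assumes "finite X" "Y \<subseteq> X" "\<And>v. v \<in> Y \<Longrightarrow> nbrs E X v \<subseteq> Y"
  shows "esize E X = esize E (X - Y) + esize E Y"
proof -
  have "nbrs E (X - Y) v = {}" if "v \<in> Y" for v
    using assms(3)[OF that] by (auto simp: nbrs_def)
  then show ?thesis using esize_split'[OF assms(1,2)] by simp
qed

end

section \<open>Paths as vertex lists, longest paths and cycles\<close>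

lemma is_path_rev: "is_path E (rev p) \<longleftrightarrow> is_path E p"
  by (simp add: is_path_def successively_rev insert_commute)

lemma is_path_appendI:
  assumes "is_path E p" "is_path E q" "set p \<inter> set q = {}"
    and "p \<noteq> [] \<Longrightarrow> q \<noteq> [] \<Longrightarrow> {last p, hd q} \<in> E"
  shows "is_path E (p @ q)"
  using assms by (auto simp: is_path_def successively_append_iff)

lemma is_path_appendD:
  assumes "is_path E (p @ q)"
  shows "is_path E p" "is_path E q" "set p \<inter> set q = {}"
    "p \<noteq> [] \<Longrightarrow> q \<noteq> [] \<Longrightarrow> {last p, hd q} \<in> E"
  using assms by (auto simp: is_path_def successively_append_iff)

lemma is_path_simps [simp]:
  "is_path E []" "is_path E [x]"
  "is_path E (x # y # p) \<longleftrightarrow> x \<notin> set (y # p) \<and> {x, y} \<in> E \<and> is_path E (y # p)"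
  by (auto simp: is_path_def)

lemma is_path_ConsI:
  assumes "is_path E p" "x \<notin> set p" "p \<noteq> [] \<Longrightarrow> {x, hd p} \<in> E"
  shows "is_path E (x # p)"
  using is_path_appendI[of E "[x]" p] assms by simp

lemma is_path_take: "is_path E p \<Longrightarrow> is_path E (take k p)"
  by (metis append_take_drop_id is_path_appendD(1))

lemma length_path_le: "is_path E p \<Longrightarrow> set p \<subseteq> X \<Longrightarrow> finite X \<Longrightarrow> length p \<le> card X"
  by (metis card_mono distinct_card is_path_def)

lemma cycle_rotate:
  assumes "is_path E p" "{last p, hd p} \<in> E" "x \<in> set p"
  shows "\<exists>q. is_path E q \<and> set q = set p \<and> length q = length p \<and> hd q = x"
proof -
  obtain us vs where p: "p = us @ x # vs" using assms(3) by (meson split_list)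
  have "is_path E ((x # vs) @ us)"
  proof (rule is_path_appendI)
    show "is_path E (x # vs)" "is_path E us" "set (x # vs) \<inter> set us = {}"
      using is_path_appendD[of E us "x # vs"] assms(1) unfolding p by blast+
    assume "us \<noteq> []"
    then show "{last (x # vs), hd us} \<in> E" using assms(2) by (simp add: p)
  qed
  then show ?thesis by (intro exI[of _ "(x # vs) @ us"]) (auto simp: p)
qed

definition longest_path :: "'a set set \<Rightarrow> 'a set \<Rightarrow> 'a list \<Rightarrow> bool" where
  "longest_path E X p \<longleftrightarrow> is_path E p \<and> set p \<subseteq> X \<and>
     (\<forall>q. is_path E q \<longrightarrow> set q \<subseteq> X \<longrightarrow> length q \<le> length p)"

lemma longest_path_exists:
  assumes "finite X" "X \<noteq> {}"
  obtains p where "longest_path E X p" "p \<noteq> []"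
proof -
  obtain x where x: "x \<in> X" using assms by auto
  let ?P = "\<lambda>p. is_path E p \<and> set p \<subseteq> X"
  have "?P [x]" using x by simp
  moreover have "\<forall>p. ?P p \<longrightarrow> length p < Suc (card X)"
    using assms(1) by (auto simp: less_Suc_eq_le length_path_le)
  ultimately obtain p where p: "?P p" "\<forall>q. ?P q \<longrightarrow> length q \<le> length p"
    using ex_has_greatest_nat[of ?P "[x]" length "Suc (card X)"] by metis
  moreover have "p \<noteq> []" using p(2)[rule_format, of "[x]"] x by auto
  ultimately show thesis using that[of p] unfolding longest_path_def by blast
qed

text \<open>A neighbour of the first vertex outside the path could be put in front of it.\<close>

lemma (in sgraph) longest_path_nbrs:
  assumes "longest_path E X p" "p \<noteq> []"
  shows "nbrs E X (hd p) \<subseteq> set p - {hd p}"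
proof
  fix u assume u: "u \<in> nbrs E X (hd p)"
  then have uh: "u \<in> X" "{u, hd p} \<in> E" by (auto simp: nbrs_def insert_commute)
  have "u \<in> set p"
  proof (rule ccontr)
    assume "u \<notin> set p"
    then have "is_path E (u # p)" using assms uh by (intro is_path_ConsI) (auto simp: longest_path_def)
    then have "length (u # p) \<le> length p"
      using assms uh unfolding longest_path_def by (metis insert_subset list.simps(15))
    then show False by simp
  qed
  moreover have "u \<noteq> hd p" using uh by auto
  ultimately show "u \<in> set p - {hd p}" by simp
qed

lemma (in sgraph) longest_path_degree:
  assumes "longest_path E X p" "p \<noteq> []"
  shows "card (nbrs E X (hd p)) + 1 \<le> length p"
proof -
  have "card (nbrs E X (hd p)) \<le> card (set p - {hd p})"
    using longest_path_nbrs[OF assms] by (simp add: card_mono)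
  moreover have "card (set p) = length p" using assms by (auto simp: longest_path_def is_path_def distinct_card)
  moreover have "hd p \<in> set p" using assms by simp
  moreover have "length p > 0" using assms(2) by simp
  ultimately show ?thesis by (simp only: card_Diff_singleton)
qed

lemma longest_path_rev: "longest_path E X p \<Longrightarrow> longest_path E X (rev p)"
  by (simp add: longest_path_def is_path_rev)

lemma longest_path_cong:
  "longest_path E X p \<Longrightarrow> is_path E q \<Longrightarrow> set q = set p \<Longrightarrow> length q = length p \<Longrightarrow> longest_path E X q"
  by (simp add: longest_path_def)

text \<open>Rotating the cycle makes any of its vertices the start of a path of maximal length on
  the same vertex set. On two vertices the closing edge is the edge of the path itself, and the
  argument is unaffected.\<close>

lemma longest_cycle_closed:
  assumes "sgraph E" "longest_path E X p" "is_path E c" "{last c, hd c} \<in> E"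
    "set c = set p" "length c = length p" "v \<in> set p"
  shows "nbrs E X v \<subseteq> set p"
proof -
  interpret sgraph E by fact
  obtain q where q: "is_path E q" "set q = set c" "length q = length c" "hd q = v"
    using cycle_rotate[OF assms(3,4)] assms(5,7) by metis
  then have "longest_path E X q" using assms longest_path_cong by metis
  moreover have "q \<noteq> []" using q assms by auto
  ultimately show ?thesis using longest_path_nbrs q assms by blast
qed

text \<open>Count edges of the path: those whose later end is adjacent to the first vertex, and
  those whose earlier end is adjacent to the last vertex. There are only \<open>length p - 1\<close>
  edges, so one is of both kinds; dropping it and reversing the second half gives the cycle.\<close>

lemma (in sgraph) close_to_cycle:
  assumes p: "longest_path E X p" "p \<noteq> []"
    and deg: "card (nbrs E X (hd p)) + card (nbrs E X (last p)) \<ge> length p"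
  obtains c where "is_path E c" "{last c, hd c} \<in> E" "set c = set p" "length c = length p"
proof -
  define r where "r = length p"
  have path: "is_path E p" using p by (simp add: longest_path_def)
  have r0: "r > 0" using p by (simp add: r_def)
  let ?I = "{i. i < r - 1 \<and> {hd p, p ! Suc i} \<in> E}"
  let ?J = "{i. i < r - 1 \<and> {last p, p ! i} \<in> E}"
  have "nbrs E X (hd p) \<subseteq> (\<lambda>i. p ! Suc i) ` ?I"
  proof
    fix u assume u: "u \<in> nbrs E X (hd p)"
    then have "u \<in> set p" "u \<noteq> hd p" using longest_path_nbrs[OF p] by auto
    then obtain j where j: "j < r" "u = p ! j" by (auto simp: in_set_conv_nth r_def)
    then have "j \<noteq> 0" using \<open>u \<noteq> hd p\<close> p by (metis hd_conv_nth)
    then obtain i where "j = Suc i" by (cases j) auto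
    then show "u \<in> (\<lambda>i. p ! Suc i) ` ?I" using u j by (auto simp: nbrs_def)
  qed
  then have I: "card (nbrs E X (hd p)) \<le> card ?I"
    by (intro surj_card_le) auto
  have rp: "longest_path E X (rev p)" "rev p \<noteq> []" using p longest_path_rev by auto
  have "nbrs E X (last p) \<subseteq> (\<lambda>i. p ! i) ` ?J"
  proof
    fix u assume u: "u \<in> nbrs E X (last p)"
    then have "u \<in> set p" "u \<noteq> last p" using longest_path_nbrs[OF rp] p by (auto simp: hd_rev)
    then obtain j where j: "j < r" "u = p ! j" by (auto simp: in_set_conv_nth r_def)
    then have "j \<noteq> r - 1" using \<open>u \<noteq> last p\<close> p by (metis last_conv_nth r_def)
    then show "u \<in> (\<lambda>i. p ! i) ` ?J" using u j by (auto simp: nbrs_def)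
  qed
  then have J: "card (nbrs E X (last p)) \<le> card ?J"
    by (intro surj_card_le) auto
  have "?I \<inter> ?J \<noteq> {}"
  proof
    assume "?I \<inter> ?J = {}"
    then have "card (?I \<union> ?J) = card ?I + card ?J" by (intro card_Un_disjoint) auto
    moreover have "card (?I \<union> ?J) \<le> card {..<r - 1}" by (intro card_mono) auto
    ultimately show False using I J deg r0 unfolding r_def[symmetric] by simp
  qed
  then obtain i where i: "i < r - 1" "{hd p, p ! Suc i} \<in> E" "{last p, p ! i} \<in> E" by auto
  define xs ys where "xs = take (Suc i) p" and "ys = drop (Suc i) p"
  have pe: "p = xs @ ys" by (simp add: xs_def ys_def)
  have ne: "xs \<noteq> []" "ys \<noteq> []" using i p by (auto simp: xs_def ys_def r_def)
  have lx: "last xs = p ! i" using i by (simp add: xs_def r_def take_Suc_conv_app_nth)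
  have hy: "hd ys = p ! Suc i" using i by (simp add: ys_def r_def hd_drop_conv_nth)
  have ly: "last ys = last p" using ne by (simp add: pe)
  have hx: "hd xs = hd p" using ne by (simp add: pe)
  have parts: "is_path E xs" "is_path E ys" "set xs \<inter> set ys = {}"
    using is_path_appendD[of E xs ys] path pe by auto
  show thesis
  proof (rule that[of "xs @ rev ys"])
    show "is_path E (xs @ rev ys)"
      using parts i lx ly ne by (intro is_path_appendI) (auto simp: is_path_rev hd_rev insert_commute)
    show "{last (xs @ rev ys), hd (xs @ rev ys)} \<in> E"
      using ne hx hy i by (simp add: last_rev insert_commute)
  qed (use pe in auto)
qed

text \<open>Minimal counterexamples have large minimum degree, so a longest path closes to a cycle whose
  vertex set is a component with fewer than m vertices; deleting it is cheap.\<close>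
theorem Erdos_Gallai:
  assumes "sgraph E" "finite X" "m \<ge> 2"
    and nopath: "\<And>p. is_path E p \<Longrightarrow> set p \<subseteq> X \<Longrightarrow> length p \<noteq> m"
  shows "2 * esize E X + 2 * card X \<le> m * card X"
proof -
  interpret sgraph E by fact
  from assms(2) nopath show ?thesis
  proof (induction "card X" arbitrary: X rule: less_induct)
    case less
    show ?case
    proof (cases "X = {}")
      case False
      show ?thesis
      proof (cases "\<exists>v\<in>X. 2 * card (nbrs E X v) + 2 \<le> m")
        case True
        then obtain v where v: "v \<in> X" "2 * card (nbrs E X v) + 2 \<le> m" by auto
        have lt: "card (X - {v}) < card X" using v less.prems(1) by (meson card_Diff1_less)
        have "2 * esize E (X - {v}) + 2 * card (X - {v}) \<le> m * card (X - {v})"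
          using less.prems by (intro less.hyps lt) auto
        moreover have cX: "card X = Suc (card (X - {v}))" using v less.prems(1) by (metis card.remove)
        then have "m * card X = m * card (X - {v}) + m" by simp
        ultimately show ?thesis
          using v esize_remove[OF less.prems(1) v(1)] cX by linarith
      next
        case nodeg: False
        obtain p where p: "longest_path E X p" "p \<noteq> []"
          using longest_path_exists[OF less.prems(1) False, of E] by blast
        have sub: "set p \<subseteq> X" and path: "is_path E p" using p by (auto simp: longest_path_def)
        have cp: "card (set p) = length p" using path by (simp add: is_path_def distinct_card)
        have r: "length p < m"
        proof (rule ccontr)
          assume "\<not> length p < m"
          then have "length (take m p) = m" by simp
          moreover have "set (take m p) \<subseteq> X" using sub by (meson order_trans set_take_subset)
          ultimately show False using less.prems(2)[OF is_path_take[OF path]] by blast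
        qed
        have "hd p \<in> X" "last p \<in> X" using sub p by auto
        then have "2 * card (nbrs E X (hd p)) + 2 > m" "2 * card (nbrs E X (last p)) + 2 > m"
          using nodeg by auto
        \<comment> \<open>Each end has doubled degree at least \<open>m - 1\<close>, so the degrees
          add up to at least \<open>m - 1\<close>, and the path has at most that many
          vertices.\<close>
        then have "card (nbrs E X (hd p)) + card (nbrs E X (last p)) \<ge> length p" using r by linarith
        then obtain c where c: "is_path E c" "{last c, hd c} \<in> E" "set c = set p" "length c = length p"
          using close_to_cycle[OF p] by metis
        have closed: "\<And>v. v \<in> set p \<Longrightarrow> nbrs E X v \<subseteq> set p"
          using longest_cycle_closed[OF sgraph_axioms p(1) c] by blast
        have lt: "card (X - set p) < card X"
          using \<open>hd p \<in> X\<close> p less.prems(1) hd_in_set[of p]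
          by (intro psubset_card_mono psubsetI) blast+
        have "2 * esize E (X - set p) + 2 * card (X - set p) \<le> m * card (X - set p)"
          using less.prems by (intro less.hyps lt) auto
        moreover have cX: "card X = card (X - set p) + length p"
          using sub less.prems(1) cp by (metis card_Diff_subset card_mono finite_set le_add_diff_inverse2)
        then have "m * card X = m * card (X - set p) + m * length p" by (simp only: distrib_left)
        moreover have "2 * esize E (set p) + length p \<le> length p * length p"
          using esize_bound[of "set p"] cp by simp
        moreover have "length p * length p + length p \<le> m * length p"
          using mult_le_mono1[of "Suc (length p)" m "length p"] r by simp
        moreover have "esize E X = esize E (X - set p) + esize E (set p)"
          using esize_remove_closed[OF less.prems(1) sub closed] .
        ultimately show ?thesis using cX by linarith
      qed
    qed simp
  qed
qed

section \<open>Linear forests\<close>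

definition joined :: "'a set set \<Rightarrow> 'a set \<Rightarrow> 'a set \<Rightarrow> bool" where
  "joined E A W \<longleftrightarrow> A \<inter> W = {} \<and> (\<forall>a\<in>A. \<forall>w\<in>W. {a, w} \<in> E)"

text \<open>This is the vertex cover number of the linear forest, since \<open>m div 2\<close>
  vertices are needed to meet all edges of a path of order \<open>m\<close>. For the forest of the
  theorem it is the parameter l.\<close>

definition halves :: "nat list \<Rightarrow> nat" where
  "halves ms = (\<Sum>m\<leftarrow>ms. m div 2)"

lemma halves_simps [simp]:
  "halves [] = 0" "halves (m # ms) = m div 2 + halves ms" "halves (as @ bs) = halves as + halves bs"
  by (auto simp: halves_def)

lemma joined_mono: "joined E A W \<Longrightarrow> A' \<subseteq> A \<Longrightarrow> W' \<subseteq> W \<Longrightarrow> joined E A' W'"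
  unfolding joined_def by blast

lemma has_forest_mono: "X \<subseteq> Y \<Longrightarrow> has_forest E X ms \<Longrightarrow> has_forest E Y ms"
proof (induction ms arbitrary: X Y)
  case (Cons m ms)
  from Cons.prems(2) obtain p where p: "is_path E p" "set p \<subseteq> X" "length p = m"
    "has_forest E (X - set p) ms" by auto
  have "has_forest E (Y - set p) ms" by (rule Cons.IH[OF _ p(4)]) (use Cons.prems(1) in auto)
  moreover have "set p \<subseteq> Y" using p(2) Cons.prems(1) by blast
  ultimately show ?case using p(1,3) by (simp only: has_forest.simps) blast
qed simp

lemma has_forest_front: "has_forest E X (m # as @ bs) \<Longrightarrow> has_forest E X (as @ m # bs)"
proof (induction as arbitrary: X)
  case (Cons a as)
  from Cons.prems obtain p q where p: "is_path E p" "set p \<subseteq> X" "length p = m"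
    and q: "is_path E q" "set q \<subseteq> X - set p" "length q = a" "has_forest E (X - set p - set q) (as @ bs)"
    by auto
  have "has_forest E (X - set q) (m # as @ bs)"
    using p q by (auto intro!: exI[of _ p] simp: Diff_eq Int_ac)
  then have "has_forest E (X - set q) (as @ m # bs)" by (rule Cons.IH)
  with q show ?case by (auto intro!: exI[of _ q])
qed simp

lemma has_forest_core:
  assumes "has_forest E X ms"
  obtains Q where "Q \<subseteq> X" "finite Q" "card Q = sum_list ms" "has_forest E Q ms"
  using assms
proof (induction ms arbitrary: X thesis)
  case (Cons m ms)
  from Cons.prems(2) obtain p where p: "is_path E p" "set p \<subseteq> X" "length p = m"
    "has_forest E (X - set p) ms" by auto
  obtain Q where Q: "Q \<subseteq> X - set p" "finite Q" "card Q = sum_list ms" "has_forest E Q ms"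
    using Cons.IH[OF _ p(4)] by blast
  have dis: "set p \<inter> Q = {}" using Q by auto
  then have "set p \<union> Q - set p = Q" by auto
  then have "has_forest E (set p \<union> Q) (m # ms)" using p Q by auto
  moreover have "card (set p \<union> Q) = sum_list (m # ms)"
    using p Q dis by (simp add: card_Un_disjoint distinct_card is_path_def)
  ultimately show ?case using Cons.prems(1)[of "set p \<union> Q"] p Q by auto
qed auto

text \<open>Each round appends one vertex of \<open>A\<close> and one of \<open>W\<close>. Ending in
  \<open>W\<close> makes the new last vertex adjacent to all of \<open>A\<close> again, so only the
  original end needs an assumption. The exact number of vertices of \<open>A\<close> spent is
  recorded because \<open>A\<close> is the scarce side.\<close>

lemma extend_path:
  assumes "is_path E p" "p \<noteq> []" "joined E A W" "set p \<inter> (A \<union> W) = {}"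
    and "j \<le> card A" "j \<le> card W" "\<And>a. a \<in> A \<Longrightarrow> {last p, a} \<in> E"
  shows "\<exists>q. is_path E (p @ q) \<and> set q \<subseteq> A \<union> W \<and> length q = 2 * j \<and> card (set q \<inter> A) = j"
  using assms
proof (induction j arbitrary: p A W)
  case 0
  then show ?case by (intro exI[of _ "[]"]) auto
next
  case (Suc j)
  have fin: "finite A" "finite W" using Suc.prems(5,6) by (metis card.infinite not_less_eq_eq zero_le)+
  obtain a w where a: "a \<in> A" and w: "w \<in> W" using Suc.prems(5,6) by fastforce
  have aw: "{a, w} \<in> E" "a \<noteq> w" using Suc.prems(3) a w by (auto simp: joined_def)
  let ?p = "p @ [a, w]"
  have "is_path E ?p"
    using Suc.prems a w aw by (intro is_path_appendI) auto
  moreover have "set ?p \<inter> ((A - {a}) \<union> (W - {w})) = {}"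
    using Suc.prems(3,4) a w by (auto simp: joined_def)
  moreover have "{last ?p, b} \<in> E" if "b \<in> A - {a}" for b
    using Suc.prems(3) w that by (auto simp: joined_def insert_commute)
  moreover have "joined E (A - {a}) (W - {w})" using Suc.prems(3) by (rule joined_mono) auto
  moreover have "j \<le> card (A - {a})" "j \<le> card (W - {w})" using Suc.prems(5,6) a w by simp_all
  ultimately obtain q where q: "is_path E (?p @ q)" "set q \<subseteq> (A - {a}) \<union> (W - {w})"
      "length q = 2 * j" "card (set q \<inter> (A - {a})) = j"
    using Suc.IH[of ?p "A - {a}" "W - {w}"] by blast
  have "w \<notin> A" using Suc.prems(3) w by (auto simp: joined_def)
  then have "set (a # w # q) \<inter> A = insert a (set q \<inter> (A - {a}))" using a by auto
  then have "card (set (a # w # q) \<inter> A) = Suc j" using q(4) by simp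
  moreover have "is_path E (p @ a # w # q)" using q(1) by simp
  moreover have "set (a # w # q) \<subseteq> A \<union> W" using q(2) a w by auto
  moreover have "length (a # w # q) = 2 * Suc j" using q(3) by simp
  ultimately show ?case by blast
qed

text \<open>Starting in \<open>W\<close> is the economical choice: one vertex of \<open>W\<close>
  followed by \<open>m div 2\<close> pairs has at least \<open>m\<close> vertices, and cutting it to
  order \<open>m\<close> keeps at most \<open>m div 2\<close> of them in \<open>A\<close>.\<close>

lemma joined_path:
  assumes "joined E A W" "m div 2 \<le> card A" "m \<le> card W"
  shows "\<exists>p. is_path E p \<and> set p \<subseteq> A \<union> W \<and> length p = m \<and> card (set p \<inter> A) \<le> m div 2"
proof (cases "m = 0")
  case False
  then have "card W \<noteq> 0" using assms(3) by simp
  then have fW: "finite W" "W \<noteq> {}" by (auto intro: ccontr)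
  then obtain w where w: "w \<in> W" by auto
  have "m div 2 \<le> card (W - {w})" using w assms(3) False by simp
  moreover have "joined E A (W - {w})" using assms(1) by (rule joined_mono) auto
  moreover have "set [w] \<inter> (A \<union> (W - {w})) = {}" using assms(1) w by (auto simp: joined_def)
  moreover have "{last [w], a} \<in> E" if "a \<in> A" for a
    using assms(1) w that by (auto simp: joined_def insert_commute)
  ultimately obtain q where q: "is_path E ([w] @ q)" "set q \<subseteq> A \<union> (W - {w})"
      "length q = 2 * (m div 2)" "card (set q \<inter> A) = m div 2"
    using extend_path[of E "[w]" A "W - {w}" "m div 2"] assms(2) by auto
  define p where "p = take m (w # q)"
  have "set p \<subseteq> set (w # q)" unfolding p_def by (rule set_take_subset)
  moreover have "w \<notin> A" using assms(1) w by (auto simp: joined_def)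
  ultimately have "set p \<inter> A \<subseteq> set q \<inter> A" by auto
  then have "card (set p \<inter> A) \<le> m div 2" using q(4) by (metis card_mono finite_Int finite_set)
  moreover have "m \<le> Suc (2 * (m div 2))" by presburger
  then have "length p = m" using q(3) by (simp only: p_def length_take list.size)
  moreover have "is_path E p" using q(1) by (simp add: p_def is_path_take del: take_Suc_Cons)
  moreover have "set p \<subseteq> A \<union> W" using \<open>set p \<subseteq> set (w # q)\<close> q(2) w by auto
  ultimately show ?thesis by blast
qed (auto intro: exI[of _ "[]"])

lemma joined_forest:
  assumes "joined E A W" "finite A" "finite W" "halves ms \<le> card A" "sum_list ms \<le> card W"
  shows "has_forest E (A \<union> W) ms"
  using assms
proof (induction ms arbitrary: A W)
  case (Cons m ms)
  have "m div 2 \<le> card A" "m \<le> card W" using Cons.prems(4,5) by simp_all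
  from joined_path[OF Cons.prems(1) this] obtain p where p: "is_path E p" "set p \<subseteq> A \<union> W"
    "length p = m" "card (set p \<inter> A) \<le> m div 2" by blast
  have "card A = card (A - set p) + card (set p \<inter> A)"
    using Cons.prems(2) by (metis Diff_Int_distrib2 Int_commute add.commute card_Diff_subset_Int card_mono finite_Int inf_le1 le_add_diff_inverse)
  then have A: "halves ms \<le> card (A - set p)" using p(4) Cons.prems(4) by simp
  have "card W - card (set p) \<le> card (W - set p)" by (rule diff_card_le_card_Diff) simp
  moreover have "card (set p) = m" using p by (simp add: is_path_def distinct_card)
  ultimately have W: "sum_list ms \<le> card (W - set p)" using Cons.prems(5) by simp
  have "has_forest E ((A - set p) \<union> (W - set p)) ms"
    using Cons.prems A W by (intro Cons.IH joined_mono[OF Cons.prems(1)]) auto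
  then have "has_forest E (A \<union> W - set p) ms" by (simp add: Un_Diff)
  with p show ?case by auto
qed simp

text \<open>The other paths are built greedily from what \<open>p\<close> leaves of \<open>A\<close>
  and \<open>W\<close>. It is applied when \<open>A\<close> is one vertex short of
  \<open>halves\<close>: a path that spends fewer than \<open>m div 2\<close> vertices of
  \<open>A\<close> makes up for the missing one.\<close>

lemma saving_path:
  assumes "joined E A W" "finite A" "finite W" "A \<union> W \<subseteq> X"
    and p: "is_path E p" "set p \<subseteq> X" "length p = m"
    and "halves (as @ bs) + card (set p \<inter> A) \<le> card A" "sum_list (as @ m # bs) \<le> card W"
  shows "has_forest E X (as @ m # bs)"
proof -
  have "card (A - set p) = card A - card (set p \<inter> A)"
    using assms(2) by (simp add: card_Diff_subset_Int Int_commute)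
  then have A: "halves (as @ bs) \<le> card (A - set p)" using assms(8) by simp
  have "card W - card (set p) \<le> card (W - set p)" by (rule diff_card_le_card_Diff) simp
  moreover have "card (set p) = m" using p by (simp add: is_path_def distinct_card)
  ultimately have W: "sum_list (as @ bs) \<le> card (W - set p)" using assms(9) by simp
  have "has_forest E ((A - set p) \<union> (W - set p)) (as @ bs)"
    using assms(1-3) A W by (intro joined_forest joined_mono[OF assms(1)]) auto
  then have "has_forest E (X - set p) (as @ bs)"
    by (rule has_forest_mono[rotated]) (use assms(4) in auto)
  then have "has_forest E X (m # as @ bs)" using p by auto
  then show ?thesis by (rule has_forest_front)
qed

lemma pigeonhole_card:
  assumes "finite Y" "finite B" "f ` Y \<subseteq> B" "card B * T \<le> card Y" "T > 0" "B \<noteq> {}"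
  shows "\<exists>b\<in>B. T \<le> card {y \<in> Y. f y = b}"
proof (rule ccontr)
  assume "\<not> ?thesis"
  then have less: "card {y \<in> Y. f y = b} < T" if "b \<in> B" for b using that by force
  have "Y = (\<Union>b\<in>B. {y \<in> Y. f y = b})" using assms(3) by auto
  then have "card Y \<le> (\<Sum>b\<in>B. card {y \<in> Y. f y = b})"
    using card_UN_le[OF assms(2), of "\<lambda>b. {y \<in> Y. f y = b}"] by simp
  also have "\<dots> < (\<Sum>b\<in>B. T)" using assms less by (intro sum_strict_mono) auto
  finally show False using assms(4) by simp
qed

text \<open>If P is a copy of the first path and there are many edges, then many vertices outside P have the
  same m div 2 neighbours in P, and deleting these neighbours destroys every copy of the remaining forest.\<close>
theorem linear_forest_edge_bound:
  assumes "ms \<noteq> []" "\<forall>m\<in>set ms. m \<ge> 2"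
  shows "\<exists>C. \<forall>(E :: 'a set set) X. sgraph E \<longrightarrow> finite X \<longrightarrow> \<not> has_forest E X ms \<longrightarrow>
           2 * esize E X + card X \<le> 2 * (halves ms * card X) + C"
  using assms
proof (induction ms rule: list_nonempty_induct)
  case (single m)
  have "2 * esize E X + card X \<le> 2 * (halves [m] * card X) + 0"
    if g: "sgraph E" "finite X" "\<not> has_forest E X [m]" for E :: "'a set set" and X
  proof -
    have "2 * esize E X + 2 * card X \<le> m * card X"
      using g single by (intro Erdos_Gallai) auto
    also have "\<dots> \<le> (2 * (m div 2) + 1) * card X" by (intro mult_le_mono1) simp
    finally show ?thesis by (simp add: algebra_simps)
  qed
  then show ?case by blast
next
  case (cons m ms)
  then obtain C where C: "\<And>(E :: 'a set set) X. sgraph E \<Longrightarrow> finite X \<Longrightarrow> \<not> has_forest E X ms \<Longrightarrow>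
      2 * esize E X + card X \<le> 2 * (halves ms * card X) + C"
    by auto
  have m2: "m \<ge> 2" using cons.prems by simp
  define l where "l = m div 2"
  have l1: "l \<ge> 1" "l \<le> m" using m2 by (auto simp: l_def)
  define T where "T = sum_list (m # ms)"
  have T0: "T > 0" using m2 by (simp add: T_def)
  \<comment> \<open>There are \<open>2 ^ m\<close> possible neighbourhoods in the path, and
    \<open>T\<close> vertices with the same one suffice: after a copy of the remaining forest is
    removed, \<open>m\<close> of them are left to rebuild the first path.\<close>
  define K where "K = 2 ^ m * T"
  let ?C = "C + m * m + m + 2 * (m * K)"
  have "2 * esize E X + card X \<le> 2 * (halves (m # ms) * card X) + ?C"
    if g: "sgraph E" "finite X" "\<not> has_forest E X (m # ms)" for E :: "'a set set" and X
  proof (cases "\<exists>p. is_path E p \<and> set p \<subseteq> X \<and> length p = m")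
    case False
    have "2 * esize E X + 2 * card X \<le> m * card X"
      using g m2 False by (intro Erdos_Gallai) auto
    also have "\<dots> \<le> (2 * (m div 2) + 1) * card X" by (intro mult_le_mono1) simp
    finally have "2 * esize E X + card X \<le> 2 * ((m div 2) * card X)" by (simp add: algebra_simps)
    then show ?thesis by (simp add: algebra_simps)
  next
    case True
    then obtain p where p: "is_path E p" "set p \<subseteq> X" "length p = m" by auto
    interpret sgraph E by (rule g)
    define P where "P = set p"
    have P: "finite P" "P \<subseteq> X" "card P = m"
      using p by (auto simp: P_def is_path_def distinct_card)
    have noP: "\<not> has_forest E (X - P) ms" using g(3) p by (auto simp: P_def)
    have cX: "card X = card (X - P) + m"
      using P g(2) by (metis card_Diff_subset card_mono le_add_diff_inverse2)
    define Y where "Y = {v \<in> X - P. l \<le> card (nbrs E P v)}"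
    have fY: "finite Y" using g(2) by (simp add: Y_def)
    show ?thesis
    proof (cases "card Y < K")
      case True
      \<comment> \<open>Outside \<open>Y\<close> a vertex sends at most \<open>l - 1\<close> edges
        to \<open>P\<close>. The excess caused by \<open>Y\<close> is at most \<open>m * K\<close>,
        a constant.\<close>
      have "(\<Sum>v\<in>X - P. card (nbrs E P v) + 1) \<le> (\<Sum>v\<in>X - P. l + (if v \<in> Y then m else 0))"
      proof (rule sum_mono)
        fix v assume "v \<in> X - P"
        then show "card (nbrs E P v) + 1 \<le> l + (if v \<in> Y then m else 0)"
          using card_nbrs_le[OF P(1), of E v] P(3) l1 by (auto simp: Y_def)
      qed
      moreover have "(\<Sum>v\<in>X - P. if v \<in> Y then m else 0) = m * card Y"
        using g(2) by (simp add: sum.If_cases Y_def Int_def conj_ac)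
      ultimately have "(\<Sum>v\<in>X - P. card (nbrs E P v)) + card (X - P) \<le> l * card (X - P) + m * card Y"
        by (simp only: sum.distrib) (simp add: mult.commute)
      moreover have "m * card Y \<le> m * K" using True by simp
      moreover have "2 * esize E P + m \<le> m * m" using esize_bound[OF P(1)] P(3) by simp
      moreover have "2 * esize E (X - P) + card (X - P) \<le> 2 * (halves ms * card (X - P)) + C"
        using g(1,2) noP by (intro C) auto
      moreover have "esize E X = esize E (X - P) + esize E P + (\<Sum>v\<in>X - P. card (nbrs E P v))"
        using g(2) P(2) by (rule esize_split)
      ultimately have "2 * esize E X + card X \<le>
          2 * (halves ms * card (X - P)) + 2 * (l * card (X - P)) + C + m * m + m + 2 * (m * K)"
        using cX by linarith
      also have "\<dots> \<le> 2 * (halves ms * card X) + 2 * (l * card X) + C + m * m + m + 2 * (m * K)"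
        using cX by (intro add_mono mult_le_mono) auto
      finally show ?thesis by (simp add: algebra_simps l_def)
    next
      case False
      have "\<exists>S\<in>Pow P. T \<le> card {y \<in> Y. nbrs E P y = S}"
        using fY P T0 False
        by (intro pigeonhole_card) (auto simp: nbrs_def K_def card_Pow)
      then obtain S where S: "S \<subseteq> P" "T \<le> card {y \<in> Y. nbrs E P y = S}" by auto
      define W where "W = {y \<in> Y. nbrs E P y = S}"
      have fW: "finite W" "T \<le> card W" using fY S by (auto simp: W_def)
      then have "W \<noteq> {}" using T0 by auto
      then have "l \<le> card S" by (auto simp: W_def Y_def)
      then obtain S' where S': "S' \<subseteq> S" "card S' = l" "finite S'" using obtain_subset_with_card_n by metis
      have S'X: "S' \<subseteq> X" using S S' P by auto
      have "w \<notin> P" "s \<in> nbrs E P w" if "w \<in> W" "s \<in> S'" for w s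
        using that S' by (auto simp: W_def Y_def)
      then have J: "joined E S' W" using S S' by (fastforce simp: joined_def nbrs_def insert_commute)
      have no: "\<not> has_forest E (X - S') ms"
      proof
        assume "has_forest E (X - S') ms"
        then obtain Q where Q: "Q \<subseteq> X - S'" "finite Q" "card Q = sum_list ms" "has_forest E Q ms"
          by (rule has_forest_core)
        have "card W - card Q \<le> card (W - Q)" using Q(2) by (rule diff_card_le_card_Diff)
        then have "m \<le> card (W - Q)" using fW Q(3) by (simp add: T_def)
        moreover have "joined E S' (W - Q)" using J by (rule joined_mono) auto
        ultimately obtain q where q: "is_path E q" "set q \<subseteq> S' \<union> (W - Q)" "length q = m"
          using joined_path[of E S' "W - Q" m] S' by (auto simp: l_def)
        have "Q \<subseteq> X - set q" using Q q by auto
        then have "has_forest E (X - set q) ms" using Q(4) has_forest_mono by blast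
        moreover have "set q \<subseteq> X" using q S'X by (auto simp: W_def Y_def)
        ultimately show False using g(3) q by auto
      qed
      have cX: "card X = card (X - S') + l"
        using S' S'X g(2) by (metis card_Diff_subset card_mono le_add_diff_inverse2)
      have "(\<Sum>v\<in>X - S'. card (nbrs E S' v)) \<le> (\<Sum>v\<in>X - S'. l)"
        using card_nbrs_le[OF S'(3), of E] S'(2) by (intro sum_mono) auto
      then have "(\<Sum>v\<in>X - S'. card (nbrs E S' v)) \<le> l * card (X - S')" by (simp add: mult.commute)
      moreover have "2 * esize E S' + l \<le> l * l" using esize_bound[OF S'(3)] S'(2) by simp
      moreover have "l * l \<le> m * m" using l1 by (intro mult_le_mono)
      moreover have "2 * esize E (X - S') + card (X - S') \<le> 2 * (halves ms * card (X - S')) + C"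
        using g(1,2) no by (intro C) auto
      moreover have "esize E X = esize E (X - S') + esize E S' + (\<Sum>v\<in>X - S'. card (nbrs E S' v))"
        using g(2) S'X by (rule esize_split)
      ultimately have "2 * esize E X + card X \<le>
          2 * (halves ms * card (X - S')) + 2 * (l * card (X - S')) + C + m * m + m + 2 * (m * K)"
        using cX l1 by linarith
      also have "\<dots> \<le> 2 * (halves ms * card X) + 2 * (l * card X) + C + m * m + m + 2 * (m * K)"
        using cX by (intro add_mono mult_le_mono) auto
      finally show ?thesis by (simp add: algebra_simps l_def)
    qed
  qed
  then show ?case by blast
qed

section \<open>Dense graphs without a linear forest\<close>

lemma sum_minus_subset:
  fixes s :: "'a \<Rightarrow> nat"
  assumes "finite Z" "Y \<subseteq> Z"
  shows "(\<Sum>v\<in>Z. s v) = (\<Sum>v\<in>Z - Y. s v) + (\<Sum>v\<in>Y. s v)"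
  using assms by (simp add: sum.subset_diff)

lemma card_minus_subset:
  assumes "finite Z" "Y \<subseteq> Z"
  shows "card Z = card (Z - Y) + card Y"
  using assms by (metis card_Diff_subset card_mono finite_subset le_add_diff_inverse2)

lemma card_Int_split:
  assumes "finite Z" "Y \<subseteq> Z"
  shows "card (Z \<inter> B) = card ((Z - Y) \<inter> B) + card (Y \<inter> B)"
proof -
  have "Z \<inter> B = ((Z - Y) \<inter> B) \<union> (Y \<inter> B)" using assms by auto
  also have "card \<dots> = card ((Z - Y) \<inter> B) + card (Y \<inter> B)"
    using assms by (intro card_Un_disjoint) (auto intro: finite_subset)
  finally show ?thesis .
qed

lemma length_2_cases: "length p = 2 \<Longrightarrow> \<exists>x y. p = [x, y]"
  by (cases p; cases "tl p") auto

text \<open>Here s v counts the neighbours of v in a set of vertices of large degree and B is a small set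
  of exceptional vertices. The proof deletes an end vertex of a longest path, or a whole component
  that is an edge or a clique.\<close>
lemma weighted_deletion_bound:
  fixes s :: "'a \<Rightarrow> nat"
  assumes "sgraph E" "finite Z" "l \<ge> 1" "2 * l \<le> L" "m \<le> 2 * l + 1"
    and "\<And>p. is_path E p \<Longrightarrow> set p \<subseteq> Z \<Longrightarrow> length p < m"
    and "\<And>p j. is_path E p \<Longrightarrow> set p \<subseteq> Z \<Longrightarrow> p \<noteq> [] \<Longrightarrow> hd p \<notin> B \<Longrightarrow> j \<le> s (hd p) \<Longrightarrow> j < l
           \<Longrightarrow> length p + 2 * j < m"
    and "\<And>v. v \<in> Z \<Longrightarrow> v \<notin> B \<Longrightarrow> s v + 2 \<le> L"
    and "\<And>v. v \<in> Z \<Longrightarrow> s v \<le> a"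
  shows "2 * ((\<Sum>v\<in>Z. s v) + esize E Z) + 3 * card Z \<le> 2 * (L * card Z) + (2 * a + 1) * card (Z \<inter> B)"
proof -
  interpret sgraph E by fact
  from assms(2,6-9) show ?thesis
  proof (induction "card Z" arbitrary: Z rule: less_induct)
    case less
    note fin = less.prems(1) and nopath = less.prems(2) and ext = less.prems(3)
      and good = less.prems(4) and sa = less.prems(5)
    \<comment> \<open>The price of one exceptional vertex: \<open>s v\<close> up to \<open>a\<close>
      and degree up to \<open>L - 1\<close> give 2 (a + L - 1) + 3 = 2 L + (2 a + 1).\<close>
    define c where "c = 2 * a + 1"
    define D where "D Y = 2 * ((\<Sum>v\<in>Y. s v) + esize E Y) + 3 * card Y" for Y
    have delete: "D Z \<le> 2 * (L * card Z) + c * card (Z \<inter> B)"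
      if Y: "Y \<subseteq> Z" "Y \<noteq> {}" and d: "esize E Z = esize E (Z - Y) + e"
        "2 * ((\<Sum>v\<in>Y. s v) + e) + 3 * card Y \<le> 2 * (L * card Y) + c * card (Y \<inter> B)" for Y e
    proof -
      have "card (Z - Y) < card Z" using Y fin by (intro psubset_card_mono) auto
      then have "D (Z - Y) \<le> 2 * (L * card (Z - Y)) + c * card ((Z - Y) \<inter> B)"
        unfolding D_def c_def
        using fin nopath ext good sa by (intro less.hyps) (auto intro: less.prems)
      moreover note sum_minus_subset[OF fin Y(1), of s] card_minus_subset[OF fin Y(1)]
        card_Int_split[OF fin Y(1), of B]
      ultimately show ?thesis using d unfolding D_def by (simp add: algebra_simps)
    qed
    have "D Z \<le> 2 * (L * card Z) + c * card (Z \<inter> B)"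
    proof (cases "Z = {}")
      case False
      \<comment> \<open>The permitted rate is L - 3/2, so a single vertex outside \<open>B\<close>
        can be deleted whenever \<open>s v\<close> plus its degree is at most \<open>L - 2\<close>.
        If this fails for every start of a longest path, either some such start has a positive
        weight or all have weight zero.\<close>
      show ?thesis
      proof (cases "\<exists>p. longest_path E Z p \<and> p \<noteq> [] \<and>
                (hd p \<in> B \<or> s (hd p) + card (nbrs E Z (hd p)) + 2 \<le> L)")
        case True
        then obtain p where p: "longest_path E Z p" "p \<noteq> []"
          and c: "hd p \<in> B \<or> s (hd p) + card (nbrs E Z (hd p)) + 2 \<le> L" by auto
        define v where "v = hd p"
        have v: "v \<in> Z" using p by (auto simp: v_def longest_path_def)
        have "card (nbrs E Z v) + 1 \<le> length p" using longest_path_degree[OF p] by (simp add: v_def)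
        moreover have "length p < m" using p by (intro nopath) (auto simp: longest_path_def)
        ultimately have d: "card (nbrs E Z v) + 1 \<le> L" using assms(4,5) by linarith
        have e: "esize E Z = esize E (Z - {v}) + card (nbrs E Z v)" using fin v by (rule esize_remove)
        show ?thesis
        proof (rule delete[of "{v}" "card (nbrs E Z v)"])
          show "2 * ((\<Sum>v\<in>{v}. s v) + card (nbrs E Z v)) + 3 * card {v}
                  \<le> 2 * (L * card {v}) + c * card ({v} \<inter> B)"
            using c d sa[OF v] by (cases "v \<in> B") (auto simp: v_def[symmetric] c_def)
        qed (use v e in auto)
      next
        case noA: False
        show ?thesis
        proof (cases "\<exists>p. longest_path E Z p \<and> p \<noteq> [] \<and> s (hd p) \<ge> 1")
          case True
          then obtain p where p: "longest_path E Z p" "p \<noteq> []" "s (hd p) \<ge> 1" by auto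
          have path: "is_path E p" "set p \<subseteq> Z" using p by (auto simp: longest_path_def)
          define v where "v = hd p"
          have v: "v \<in> Z" using p by (auto simp: v_def longest_path_def)
          have vB: "v \<notin> B" and big: "s v + card (nbrs E Z v) + 2 > L"
            using noA p by (auto simp: v_def)
          have d: "card (nbrs E Z v) + 1 \<le> length p"
            using longest_path_degree[OF p(1,2)] by (simp add: v_def)
          \<comment> \<open>With \<open>j = s v\<close> the extension hypothesis makes the path so
            short that \<open>s v\<close> and the degree together stay within \<open>L - 2\<close>.
            Hence \<open>s v\<close> is at least \<open>l\<close>, and \<open>j = l - 1\<close> then
            leaves a path on at most two vertices, so the component is an edge.\<close>
          have "\<not> s v < l"
          proof
            assume "s v < l"
            then have "length p + 2 * s v < m" using ext[OF path p(2), of "s v"] vB by (simp add: v_def)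
            then show False using d big assms(4,5) p(3) unfolding v_def[symmetric] by linarith
          qed
          then have "length p + 2 * (l - 1) < m"
            using ext[OF path p(2), of "l - 1"] vB assms(3) by (simp add: v_def)
          then have r2: "length p \<le> 2" using assms(3,5) by linarith
          have sv: "s v + 2 \<le> L" using good v vB by blast
          then have d1: "card (nbrs E Z v) = 1" "length p = 2" using big d r2 by linarith+
          obtain u where pu: "p = [v, u]" using length_2_cases[OF d1(2)] by (auto simp: v_def)
          have uv: "u \<noteq> v" "u \<in> Z" using path by (auto simp: pu)
          have nv: "nbrs E Z v \<subseteq> {u, v}" using longest_path_nbrs[OF p(1,2)] by (auto simp: pu)
          have nu: "nbrs E Z u \<subseteq> {u, v}"
            using longest_path_nbrs[OF longest_path_rev[OF p(1)]] by (auto simp: pu)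
          have e: "esize E Z = esize E (Z - {u, v}) + esize E {u, v}"
            using fin v uv nv nu by (intro esize_remove_closed) auto
          have e1: "esize E {u, v} \<le> 1" using esize_bound[of "{u, v}"] uv by simp
          show ?thesis
          proof (rule delete[of "{u, v}" "esize E {u, v}"])
            \<comment> \<open>Two vertices of weight \<open>L - 2\<close> together with their edge
              meet the permitted rate exactly: 2 (2 (L - 2) + 1) + 6 = 4 L.\<close>
            have "2 * (s u + s v + 1) + 6 \<le> 4 * L + c * card ({u, v} \<inter> B)"
            proof (cases "u \<in> B")
              case True
              then have "{u, v} \<inter> B = {u}" using vB by auto
              then show ?thesis using sa[OF uv(2)] sv by (simp add: c_def)
            next
              case False
              then show ?thesis using good[OF uv(2)] sv by simp
            qed
            then show "2 * ((\<Sum>v\<in>{u, v}. s v) + esize E {u, v}) + 3 * card {u, v}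
                  \<le> 2 * (L * card {u, v}) + c * card ({u, v} \<inter> B)"
              using uv e1 by simp
          qed (use v uv e in auto)
        next
          case noB: False
          obtain p where p: "longest_path E Z p" "p \<noteq> []"
            using longest_path_exists[OF fin False, of E] by blast
          have path: "is_path E p" "set p \<subseteq> Z" using p by (auto simp: longest_path_def)
          define v where "v = hd p"
          have cp: "card (set p) = length p" using path by (simp add: is_path_def distinct_card)
          have vB: "v \<notin> B" and big: "s v + card (nbrs E Z v) + 2 > L" and s0: "s v = 0"
            using noA noB p by (auto simp: v_def)
          have d: "card (nbrs E Z v) + 1 \<le> length p"
            using longest_path_degree[OF p(1,2)] by (simp add: v_def)
          have r: "length p < m" using nopath path by blast
          \<comment> \<open>All estimates are tight, so the first vertex is adjacent to the whole
            path, which closes to a cycle. Every vertex of this component then starts a longest path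
            and has weight zero. As a graph on \<open>L\<close> vertices it has at most L (L - 1) /
            2 edges, cheap enough since \<open>L\<close> is at least 2.\<close>
          have eq: "length p = 2 * l" "2 * l = L" "card (nbrs E Z v) + 1 = length p"
            using big s0 d r assms(4,5) by linarith+
          have vp: "v \<in> set p" using p by (simp add: v_def)
          have "nbrs E Z v = set p - {v}"
          proof (rule card_subset_eq)
            show "nbrs E Z v \<subseteq> set p - {v}" using longest_path_nbrs[OF p] by (simp add: v_def)
            show "card (nbrs E Z v) = card (set p - {v})" using vp cp eq(3) by simp
          qed simp
          moreover have "last p \<noteq> v"
          proof
            assume l: "last p = v"
            have "length p \<ge> 2" using eq(1) assms(3) by simp
            then obtain y q where "p = v # y # q"
              using v_def by (cases p; cases "tl p") auto
            then show False using l path(1) by (auto simp: is_path_def split: if_splits)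
          qed
          ultimately have "last p \<in> nbrs E Z v" using p(2) by simp
          then have "{last p, hd p} \<in> E" by (simp add: v_def nbrs_def insert_commute)
          note cyc = longest_cycle_closed[OF sgraph_axioms p(1) path(1) this refl refl]
          have zero: "s x = 0" if x: "x \<in> set p" for x
          proof -
            obtain q where "is_path E q" "set q = set p" "length q = length p" "hd q = x"
              using cycle_rotate[OF path(1) \<open>{last p, hd p} \<in> E\<close> x] by blast
            then have "longest_path E Z q" "q \<noteq> []" "hd q = x"
              using longest_path_cong[OF p(1)] p(2) by auto
            then show ?thesis using noB by auto
          qed
          have e: "esize E Z = esize E (Z - set p) + esize E (set p)"
            using fin path(2) cyc by (rule esize_remove_closed)
          have eb: "2 * esize E (set p) + length p \<le> length p * length p"
            using esize_bound[of "set p"] cp by simp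
          have "length p * (length p + 2) \<le> length p * (2 * L)"
            using eq assms(3) by (intro mult_le_mono2) linarith
          then have "2 * esize E (set p) + 3 * length p \<le> 2 * (L * length p)"
            using eb by (simp add: algebra_simps)
          then show ?thesis
            using path(2) p(2) e zero cp by (intro delete[of "set p" "esize E (set p)"]) auto
        qed
      qed
    qed (simp add: D_def)
    then show ?case by (simp add: D_def c_def)
  qed
qed

text \<open>The core \<open>A\<close> of linear-degree vertices is bounded, so the edges inside it
  are negligible. Were no vertex with many twins adjacent to \<open>L - 1\<close> vertices of
  \<open>A\<close>, the weighted deletion bound would contradict the density. \<open>gap\<close>
  absorbs the constant by which the extremal number falls below (L - 1) n, and \<open>M\<close> is
  the reservoir of common neighbours wanted afterwards.\<close>

theorem dense_forest_free_joined:
  fixes rest :: "nat list" and M gap :: nat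
  assumes "rest \<noteq> []" "m \<ge> 2" "\<forall>m'\<in>set rest. m \<le> m'"
  shows "\<exists>N. \<forall>(E :: 'a set set) X. sgraph E \<longrightarrow> finite X \<longrightarrow> N \<le> card X \<longrightarrow>
     \<not> has_forest E X (m # rest) \<longrightarrow>
     2 * (halves (m # rest) * card X) \<le> 2 * esize E X + 2 * card X + gap \<longrightarrow>
     (\<exists>A W. A \<subseteq> X \<and> W \<subseteq> X \<and> joined E A W \<and> card A + 1 = halves (m # rest) \<and> M \<le> card W)"
proof -
  define L where "L = halves (m # rest)"
  define l where "l = m div 2"
  have l1: "l \<ge> 1" using assms(2) by (simp add: l_def)
  have L2: "2 * l \<le> L" 
  proof -
    obtain m' r where "rest = m' # r" using assms(1) by (cases rest) auto
    then show ?thesis using assms(3) by (auto simp: L_def l_def intro: trans_le_add1 div_le_mono)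
  qed
  have ge2: "\<forall>m'\<in>set (m # rest). 2 \<le> m'" "\<forall>m'\<in>set rest. 2 \<le> m'" using assms(2,3) by force+
  obtain C1 where C1: "\<And>(E :: 'a set set) X. sgraph E \<Longrightarrow> finite X \<Longrightarrow> \<not> has_forest E X (m # rest) \<Longrightarrow>
      2 * esize E X + card X \<le> 2 * (L * card X) + C1"
    using linear_forest_edge_bound[OF list.distinct(2) ge2(1), where 'a = 'a] unfolding L_def by blast
  obtain C2 where C2: "\<And>(E :: 'a set set) X. sgraph E \<Longrightarrow> finite X \<Longrightarrow> \<not> has_forest E X rest \<Longrightarrow>
      2 * esize E X + card X \<le> 2 * (halves rest * card X) + C2"
    using linear_forest_edge_bound[OF assms(1) ge2(2), where 'a = 'a] by blast
  \<comment> \<open>Vertices outside \<open>A\<close> have degree below n / (4 m), so those on a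
    path of order \<open>m\<close> account for at most n / 4 edges. Summing degrees bounds
    \<open>card A\<close> by \<open>a\<close>. \<open>M'\<close> twins provide the \<open>M\<close>
    common neighbours, and also enough connectors after a path with fewer than \<open>m\<close>
    vertices is removed. At most \<open>2 ^ a\<close> traces on \<open>A\<close> are rare, which
    gives \<open>b\<close>, and \<open>K\<close> is the total price of these exceptions.\<close>
  define q where "q = 4 * m"
  define a where "a = q * (2 * L + 1)"
  define M' where "M' = M + 2 * m"
  define b where "b = 2 ^ a * M'"
  define K where "K = (2 * a + 1) * b"
  \<comment> \<open>The summands serve three separate contradictions or estimates: absorbing
    \<open>C1\<close> in the degree sum, the claim that paths of order \<open>m\<close> need
    \<open>l\<close> vertices of \<open>A\<close>, and the final count.\<close>
  define N where "N = C1 + (2 * C2 + 2 * m + 2 * (m * m) + 2 * gap) + (a * a + K + 3 * a + gap) + 1"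
  have "\<exists>A W. A \<subseteq> X \<and> W \<subseteq> X \<and> joined E A W \<and> card A + 1 = L \<and> M \<le> card W"
    if g: "sgraph E" "finite X" "N \<le> card X" "\<not> has_forest E X (m # rest)"
      and dense: "2 * (L * card X) \<le> 2 * esize E X + 2 * card X + gap" for E :: "'a set set" and X
  proof (rule ccontr)
    assume no: "\<not> ?thesis"
    interpret sgraph E by fact
    define n where "n = card X"
    define A where "A = {v \<in> X. n \<le> q * card (nbrs E X v)}"
    define R where "R = X - A"
    have A: "A \<subseteq> X" "finite A" using g(2) by (auto simp: A_def)
    have n0: "n > 0" using g(3) by (simp add: n_def N_def)
    have "card A * n \<le> (\<Sum>v\<in>A. q * card (nbrs E X v))"
      using sum_bounded_below[of A n "\<lambda>v. q * card (nbrs E X v)"] by (simp add: A_def)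
    also have "\<dots> \<le> (\<Sum>v\<in>X. q * card (nbrs E X v))"
      using g(2) A by (intro sum_mono2) auto
    also have "\<dots> = q * (2 * esize E X)" using handshake[OF g(2)] by (simp add: sum_distrib_left[symmetric])
    also have "\<dots> \<le> q * ((2 * L + 1) * n)"
    proof (intro mult_le_mono2)
      have "C1 \<le> n" using g(3) by (simp add: N_def n_def)
      then show "2 * esize E X \<le> (2 * L + 1) * n"
        using C1[OF g(1,2,4)] by (simp add: n_def algebra_simps)
    qed
    finally have "card A * n \<le> a * n" by (simp only: a_def mult.assoc)
    then have cA: "card A \<le> a" using n0 by simp
    have cR: "n = card R + card A" using card_minus_subset[OF g(2) A(1)] by (simp add: R_def n_def)

    have key: "l \<le> card (set p \<inter> A)" if p: "is_path E p" "set p \<subseteq> X" "length p = m" for p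
    proof (rule ccontr)
      assume "\<not> l \<le> card (set p \<inter> A)"
      then have few: "card (set p \<inter> A) + 1 \<le> l" by simp
      define P where "P = set p"
      have P: "finite P" "card P = m" "P \<subseteq> X" using p by (auto simp: P_def is_path_def distinct_card)
      have cXP: "n = card (X - P) + m" using card_minus_subset[OF g(2) P(3)] P(2) by (simp add: n_def)
      have noP: "\<not> has_forest E (X - P) rest" using g(4) p by (auto simp: P_def)
      have s1: "(\<Sum>v\<in>P \<inter> A. card (nbrs E (X - P) v)) \<le> card (P \<inter> A) * n"
      proof -
        have "card (nbrs E (X - P) v) \<le> n" for v
          using card_nbrs_le[of "X - P" E v] g(2) cXP by simp
        then show ?thesis using sum_bounded_above[of "P \<inter> A" "\<lambda>v. card (nbrs E (X - P) v)" n] by simp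
      qed
      have s2: "4 * m * (\<Sum>v\<in>P - A. card (nbrs E (X - P) v)) \<le> m * n"
      proof -
        have "q * card (nbrs E (X - P) v) \<le> n" if "v \<in> P - A" for v
        proof -
          have "q * card (nbrs E (X - P) v) \<le> q * card (nbrs E X v)"
            using g(2) by (intro mult_le_mono2 card_mono nbrs_mono) auto
          also have "\<dots> \<le> n" using that P(3) by (auto simp: A_def)
          finally show ?thesis .
        qed
        then have "(\<Sum>v\<in>P - A. q * card (nbrs E (X - P) v)) \<le> card (P - A) * n"
          using sum_bounded_above[of "P - A" "\<lambda>v. q * card (nbrs E (X - P) v)" n] by simp
        also have "\<dots> \<le> m * n" using P by (intro mult_le_mono1) (metis Diff_subset card_mono)
        finally show ?thesis by (simp add: q_def sum_distrib_left)
      qed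
      then have s2': "4 * (\<Sum>v\<in>P - A. card (nbrs E (X - P) v)) \<le> n"
        using assms(2) by simp
      have "(\<Sum>v\<in>P. card (nbrs E (X - P) v)) =
          (\<Sum>v\<in>P \<inter> A. card (nbrs E (X - P) v)) + (\<Sum>v\<in>P - A. card (nbrs E (X - P) v))"
        using P(1) by (rule sum.Int_Diff)
      moreover have "card (P \<inter> A) * n + n \<le> l * n"
        using mult_le_mono1[OF few, of n] by (simp add: P_def)
      moreover have "esize E X = esize E (X - P) + esize E P + (\<Sum>v\<in>P. card (nbrs E (X - P) v))"
        using g(2) P(3) by (rule esize_split')
      moreover have "2 * esize E P + m \<le> m * m" using esize_bound[OF P(1)] P(2) by simp
      moreover have "2 * esize E (X - P) + card (X - P) \<le> 2 * (halves rest * card (X - P)) + C2"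
        using g(1,2) noP by (intro C2) auto
      moreover have "halves rest * card (X - P) \<le> halves rest * n" using cXP by simp
      moreover have "L * n = l * n + halves rest * n" by (simp add: L_def l_def algebra_simps)
      ultimately have "n \<le> 2 * C2 + 2 * m + 2 * (m * m) + 2 * gap"
        using dense s1 s2' cXP unfolding n_def[symmetric] by linarith
      then show False using g(3) by (simp add: N_def n_def)
    qed

    have RX: "R \<subseteq> X" "finite R" "R \<inter> A = {}" using g(2) by (auto simp: R_def)
    have short: "length p < m" if "is_path E p" "set p \<subseteq> R" for p
    proof (rule ccontr)
      assume "\<not> length p < m"
      then have "length (take m p) = m" by simp
      moreover have "set (take m p) \<subseteq> R" using that(2) by (meson order_trans set_take_subset)
      ultimately have "l \<le> card (set (take m p) \<inter> A)" using RX(1) that(1)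
        by (intro key is_path_take) auto
      moreover have "set (take m p) \<inter> A = {}" using \<open>set (take m p) \<subseteq> R\<close> RX(3) by auto
      ultimately show False using l1 by simp
    qed
    \<comment> \<open>Vertices of R outside the small set B have many twins with respect to A, which serve as
      connectors between any two of their neighbours in A.\<close>
    define cls where "cls v = {u \<in> R. nbrs E A u = nbrs E A v}" for v
    define B where "B = {v \<in> R. card (cls v) < M'}"
    have M'0: "M' > 0" using assms(2) by (simp add: M'_def)
    have fcls: "finite (cls v)" for v using RX(2) by (simp add: cls_def)
    have jcls: "joined E (nbrs E A v) (cls v)" for v
    proof -
      have "nbrs E A v \<inter> cls v = {}" using RX(3) by (auto simp: cls_def nbrs_def)
      moreover have "{a', w} \<in> E" if "a' \<in> nbrs E A v" "w \<in> cls v" for a' w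
      proof -
        have "a' \<in> nbrs E A w" using that by (simp add: cls_def)
        then show ?thesis by (simp add: nbrs_def insert_commute)
      qed
      ultimately show ?thesis by (simp add: joined_def)
    qed
    have cB: "card B \<le> b"
    proof (rule ccontr)
      assume "\<not> card B \<le> b"
      have "card (Pow A) * M' \<le> 2 ^ a * M'"
        using A cA by (simp add: card_Pow power_increasing)
      then have "card (Pow A) * M' \<le> card B" using \<open>\<not> card B \<le> b\<close> unfolding b_def by linarith
      then have "\<exists>S\<in>Pow A. M' \<le> card {y \<in> B. nbrs E A y = S}"
        using A(2) RX(2) M'0 by (intro pigeonhole_card) (auto simp: B_def nbrs_def)
      then obtain S where S: "M' \<le> card {y \<in> B. nbrs E A y = S}" by auto
      then have "{y \<in> B. nbrs E A y = S} \<noteq> {}" using M'0 by (metis card.empty not_le)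
      then obtain y where y: "y \<in> B" "nbrs E A y = S" by auto
      then have "{y \<in> B. nbrs E A y = S} \<subseteq> cls y" by (auto simp: B_def cls_def)
      then have "M' \<le> card (cls y)" using S fcls card_mono le_trans by metis
      then show False using y by (simp add: B_def)
    qed
    have wd: "2 * ((\<Sum>v\<in>R. card (nbrs E A v)) + esize E R) + 3 * card R
        \<le> 2 * (L * card R) + (2 * a + 1) * card (R \<inter> B)"
    proof (rule weighted_deletion_bound[where l = l and m = m])
      show "m \<le> 2 * l + 1" unfolding l_def by presburger
      show "card (nbrs E A v) \<le> a" for v using card_nbrs_le[OF A(2), of E v] cA by simp
      show "card (nbrs E A v) + 2 \<le> L" if v: "v \<in> R" "v \<notin> B" for v
      proof (rule ccontr)
        assume "\<not> card (nbrs E A v) + 2 \<le> L"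
        then have "L - 1 \<le> card (nbrs E A v)" by simp
        then obtain A' where A': "A' \<subseteq> nbrs E A v" "card A' = L - 1"
          using obtain_subset_with_card_n by metis
        have "joined E A' (cls v)" using jcls A'(1) by (rule joined_mono) simp
        moreover have "M \<le> card (cls v)" using v by (simp add: B_def M'_def)
        moreover have "A' \<subseteq> X" "cls v \<subseteq> X" using A'(1) A(1) RX(1) by (auto simp: nbrs_def cls_def)
        moreover have "card A' + 1 = L" using A'(2) l1 L2 by simp
        ultimately show False using no by blast
      qed
      \<comment> \<open>Otherwise the reversed path, which ends in \<open>hd p\<close>, continues
        alternately through \<open>j\<close> neighbours of \<open>hd p\<close> in \<open>A\<close>
        and twins of \<open>hd p\<close>. This yields a path of order \<open>m\<close> with at most
        \<open>j < l\<close> vertices of \<open>A\<close>.\<close>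
      show "length p + 2 * j < m"
        if p: "is_path E p" "set p \<subseteq> R" "p \<noteq> []" "hd p \<notin> B" "j \<le> card (nbrs E A (hd p))" "j < l" for p j
      proof (rule ccontr)
        assume long: "\<not> length p + 2 * j < m"
        define v where "v = hd p"
        have v: "v \<in> R" using p by (auto simp: v_def)
        have "M' \<le> card (cls v)" using p(4) v by (simp add: B_def v_def)
        moreover have "card (cls v) - card (set p) \<le> card (cls v - set p)" by (rule diff_card_le_card_Diff) simp
        moreover have "card (set p) < m" using short[OF p(1,2)] p(1) by (simp add: is_path_def distinct_card)
        moreover have "l \<le> m" by (simp add: l_def)
        ultimately have jc: "j \<le> card (cls v - set p)" using p(6) unfolding M'_def by linarith
        have J: "joined E (nbrs E A v) (cls v - set p)" using jcls by (rule joined_mono) auto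
        have "set (rev p) \<inter> (nbrs E A v \<union> (cls v - set p)) = {}"
          using p(2) RX(3) by (auto simp: nbrs_def)
        moreover have "{last (rev p), a'} \<in> E" if "a' \<in> nbrs E A v" for a'
          using that p(3) by (simp add: last_rev v_def nbrs_def)
        ultimately obtain r where r: "is_path E (rev p @ r)" "set r \<subseteq> nbrs E A v \<union> (cls v - set p)"
            "length r = 2 * j" "card (set r \<inter> nbrs E A v) = j"
          using extend_path[of E "rev p" "nbrs E A v" "cls v - set p" j] p J jc
          by (auto simp: is_path_rev v_def)
        define t where "t = take m (rev p @ r)"
        have st: "set t \<subseteq> set p \<union> set r" unfolding t_def using set_take_subset[of m "rev p @ r"] by auto
        have "l \<le> card (set t \<inter> A)"
        proof (rule key)
          show "is_path E t" using r(1) by (simp add: t_def is_path_take del: take_append)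
          show "length t = m" using long r(3) by (simp add: t_def)
          have "cls v \<subseteq> X" "nbrs E A v \<subseteq> X" using RX(1) A(1) by (auto simp: nbrs_def cls_def)
          then show "set t \<subseteq> X" using st r(2) p(2) RX(1) by blast
        qed
        also have "cls v \<inter> A = {}" using RX(3) by (auto simp: cls_def)
        then have "set t \<inter> A \<subseteq> set r \<inter> nbrs E A v"
          using st r(2) p(2) RX(3) by blast
        then have "card (set t \<inter> A) \<le> j" using r(4) by (metis card_mono finite_Int finite_set)
        finally show False using p(6) by simp
      qed
    qed (use g(1) RX l1 L2 short in auto)
    have "(2 * a + 1) * card (R \<inter> B) \<le> K"
    proof -
      have "R \<inter> B = B" by (auto simp: B_def)
      then show ?thesis using mult_le_mono2[OF cB] unfolding K_def by (simp only:)
    qed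
    then have "2 * ((\<Sum>v\<in>R. card (nbrs E A v)) + esize E R) + 3 * card R \<le> 2 * (L * card R) + K"
      using wd by (meson add_left_mono order_trans)
    moreover have "esize E X = esize E R + esize E A + (\<Sum>v\<in>R. card (nbrs E A v))"
      using esize_split[OF g(2) A(1)] by (simp add: R_def)
    moreover have "2 * esize E A \<le> a * a"
      using esize_bound[OF A(2)] mult_le_mono[OF cA cA] by linarith
    moreover have "L * card R \<le> L * n" using cR by simp
    \<comment> \<open>Products are abstracted to variables, which makes the inequality
      linear.\<close>
    moreover have arith: "n \<le> aa + k + 3 * a + gap"
      if "2 * (S + eR) + 3 * r \<le> 2 * Lr + k" "eX = eR + eA + S" "2 * eA \<le> aa" "Lr \<le> Ln"
        "2 * Ln \<le> 2 * eX + 2 * n + gap" "n = r + ca" "ca \<le> a" for S eR r Lr k eX eA aa Ln ca :: nat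
      using that by presburger
    ultimately have "n \<le> a * a + K + 3 * a + gap"
      using dense cR cA unfolding n_def[symmetric] by blast
    then show False using g(3) by (simp add: N_def n_def)
  qed
  then show ?thesis unfolding L_def by blast
qed

section \<open>The graph outside a complete bipartite core\<close>

text \<open>Some vertex always has weight plus degree at most \<open>d\<close> and can be deleted
  without loss. It is found on a longest path: with three or more vertices the end has weight zero
  and degree at most \<open>2 * l - 1\<close>; with two vertices the component is an edge and one of
  its ends has weight below \<open>d\<close>; a single vertex has no edge at all.\<close>

lemma attached_deletion_bound:
  fixes s :: "'a \<Rightarrow> nat"
  assumes "sgraph E" "finite Z" "2 * l \<le> d + 1"
    and "\<And>p. is_path E p \<Longrightarrow> set p \<subseteq> Z \<Longrightarrow> length p \<le> 2 * l"
    and "\<And>p. is_path E p \<Longrightarrow> set p \<subseteq> Z \<Longrightarrow> 3 \<le> length p \<Longrightarrow> s (hd p) = 0"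
    and "\<And>v. v \<in> Z \<Longrightarrow> s v \<le> d"
    and "\<And>u v. u \<in> Z \<Longrightarrow> v \<in> Z \<Longrightarrow> {u, v} \<in> E \<Longrightarrow> s u < d \<or> s v < d"
  shows "(\<Sum>v\<in>Z. s v) + esize E Z \<le> d * card Z"
proof -
  interpret sgraph E by fact
  from assms(2,4-7) show ?thesis
  proof (induction "card Z" arbitrary: Z rule: less_induct)
    case less
    note fin = less.prems(1) and short = less.prems(2) and ends = less.prems(3)
      and sd = less.prems(4) and viol = less.prems(5)
    show ?case
    proof (cases "Z = {}")
      case False
      have "\<exists>v\<in>Z. s v + card (nbrs E Z v) \<le> d"
      proof (rule ccontr)
        assume "\<not> ?thesis"
        then have big: "s v + card (nbrs E Z v) > d" if "v \<in> Z" for v using that by force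
        obtain p where p: "longest_path E Z p" "p \<noteq> []"
          using longest_path_exists[OF fin False, of E] by blast
        have path: "is_path E p" "set p \<subseteq> Z" using p by (auto simp: longest_path_def)
        have v: "hd p \<in> Z" using p path by auto
        have deg: "card (nbrs E Z (hd p)) + 1 \<le> length p" using longest_path_degree[OF p] .
        show False
        proof (cases "3 \<le> length p")
          case True
          then show False using ends[OF path] big[OF v] deg short[OF path] assms(3) by linarith
        next
          case False
          then have "length p = 2" using big[OF v] sd[OF v] deg by linarith
          then obtain u where pu: "p = [hd p, u]" using length_2_cases by (metis list.sel(1))
          define w where "w = hd p"
          have pw: "p = [w, u]" using pu by (simp add: w_def)
          have u: "u \<in> Z" "w \<in> Z" "{w, u} \<in> E" using path by (auto simp: pw)
          have "card (nbrs E Z w) + 1 \<le> 2" using deg by (simp add: pw)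
          moreover have "card (nbrs E Z u) + 1 \<le> 2"
            using longest_path_degree[OF longest_path_rev[OF p(1)]] by (simp add: pw)
          ultimately show False using big[OF u(1)] big[OF u(2)] viol[OF u(2,1,3)] by linarith
        qed
      qed
      then obtain v where v: "v \<in> Z" "s v + card (nbrs E Z v) \<le> d" by auto
      have "card (Z - {v}) < card Z" using v fin by (intro psubset_card_mono) auto
      then have "(\<Sum>v\<in>Z - {v}. s v) + esize E (Z - {v}) \<le> d * card (Z - {v})"
      proof (rule less.hyps)
        show "length p \<le> 2 * l" if "is_path E p" "set p \<subseteq> Z - {v}" for p using short that by blast
        show "s (hd p) = 0" if "is_path E p" "set p \<subseteq> Z - {v}" "3 \<le> length p" for p
          using ends that by blast
      qed (use fin sd viol in auto)
      moreover have "esize E Z = esize E (Z - {v}) + card (nbrs E Z v)" using fin v(1) by (rule esize_remove)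
      moreover have "card Z = card (Z - {v}) + 1" using card_minus_subset[OF fin, of "{v}"] v by simp
      then have "d * card Z = d * card (Z - {v}) + d" by (simp only: distrib_left)
      moreover have "(\<Sum>v\<in>Z. s v) = (\<Sum>v\<in>Z - {v}. s v) + s v"
        using sum_minus_subset[OF fin, of "{v}" s] v by simp
      ultimately show ?thesis using v(2) by linarith
    qed simp
  qed
qed

text \<open>Because \<open>A\<close> is one vertex short, every path of order \<open>m\<close> in
  \<open>ms\<close> must spend \<open>m div 2\<close> vertices of \<open>A\<close>. The order
  \<open>m0\<close> limits paths outside \<open>A\<close>. The order \<open>m1\<close>, available
  because H is not kP_3, excludes attached ends of longer paths and a second edge with both ends
  joined to \<open>A\<close>; for kP_3 a whole matching could be joined to \<open>A\<close>. The 5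
  spare vertices of \<open>W\<close> leave room for the longest starting path used, which has five
  vertices.\<close>

theorem joined_edge_bound:
  assumes "sgraph E" "finite X" "\<not> has_forest E X ms"
    and m0: "m0 \<in> set ms" "m0 \<ge> 2" "2 * (m0 div 2) \<le> halves ms"
    and m1: "m1 \<in> set ms" "m1 \<ge> 4" and even4: "\<forall>m\<in>set ms. even m \<longrightarrow> m \<ge> 4"
    and AW: "A \<subseteq> X" "W \<subseteq> X" "joined E A W" "card A + 1 = halves ms" "sum_list ms + 5 \<le> card W"
    and indep: "\<And>a b. a \<in> A \<Longrightarrow> b \<in> A \<Longrightarrow> {a, b} \<notin> E"
  shows "esize E X \<le> card A * card (X - A) \<or>
    ((\<forall>m\<in>set ms. odd m) \<and> esize E X \<le> card A * card (X - A) + 1 \<and>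
     (\<exists>x\<in>X - A. \<exists>y\<in>X - A. {x, y} \<in> E \<and> (\<forall>a\<in>A. {x, a} \<in> E \<and> {y, a} \<in> E)))"
proof -
  interpret sgraph E by fact
  have fA: "finite A" "finite W" using AW assms(2) finite_subset by auto
  have key: "m div 2 \<le> card (set p \<inter> A)"
    if "m \<in> set ms" "is_path E p" "set p \<subseteq> X" "length p = m" for m p
  proof (rule ccontr)
    assume less: "\<not> ?thesis"
    obtain as bs where ms: "ms = as @ m # bs" using \<open>m \<in> set ms\<close> by (meson split_list)
    have "has_forest E X (as @ m # bs)"
      using that AW fA less by (intro saving_path[of E A W]) (auto simp: ms)
    then show False using assms(3) ms by simp
  qed
  \<comment> \<open>The start \<open>p\<close> spends at most one vertex of \<open>A\<close>, and
    \<open>m div 2 - 2\<close> further pairs bring the total to at most \<open>m div 2 - 1\<close>,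
    one too few for a path of order \<open>m\<close>. \<open>m \<ge> 4\<close> makes the subtraction
    genuine.\<close>
  have extend: False
    if p: "is_path E p" "set p \<subseteq> X" "p \<noteq> []" "card (set p \<inter> A) \<le> 1" "length p \<le> 5"
      and m: "m \<in> set ms" "m \<ge> 4" "m + 4 \<le> length p + 2 * (m div 2)"
      and last: "\<And>a. a \<in> A \<Longrightarrow> a \<notin> set p \<Longrightarrow> {last p, a} \<in> E" for p m
  proof -
    define j where "j = m div 2 - 2"
    have j: "j + 2 = m div 2" using m(2) by (simp add: j_def)
    obtain as bs where ms: "ms = as @ m # bs" using m(1) by (meson split_list)
    have jA: "j + 2 \<le> card A + 1" using j AW(4) by (simp add: ms)
    have jW: "j \<le> sum_list ms" using j by (simp add: ms)
    have "card (A - set p) = card A - card (set p \<inter> A)"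
      using fA(1) by (simp add: card_Diff_subset_Int Int_commute)
    then have 1: "j \<le> card (A - set p)" using jA p(4) by linarith
    have "card W - card (set p) \<le> card (W - set p)" by (rule diff_card_le_card_Diff) simp
    then have 2: "j \<le> card (W - set p)" using AW(5) jW p(5) card_length[of p] by linarith
    have "joined E (A - set p) (W - set p)" using AW(3) by (rule joined_mono) auto
    then obtain q where q: "is_path E (p @ q)" "set q \<subseteq> (A - set p) \<union> (W - set p)" "length q = 2 * j"
        "card (set q \<inter> (A - set p)) = j"
      using extend_path[of E p "A - set p" "W - set p" j] p 1 2 last by auto
    define t where "t = take m (p @ q)"
    have st: "set t \<subseteq> set p \<union> set q" unfolding t_def using set_take_subset[of m "p @ q"] by auto
    have "m div 2 \<le> card (set t \<inter> A)"
    proof (rule key[OF m(1)])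
      show "is_path E t" using q(1) by (simp add: t_def is_path_take del: take_append)
      show "length t = m" using m(3) q(3) j by (simp add: t_def)
      show "set t \<subseteq> X" using st q(2) p(2) AW by blast
    qed
    also have "set t \<inter> A \<subseteq> (set p \<inter> A) \<union> (set q \<inter> (A - set p))" using st by auto
    then have "card (set t \<inter> A) \<le> card ((set p \<inter> A) \<union> (set q \<inter> (A - set p)))"
      by (intro card_mono) auto
    also have "\<dots> \<le> 1 + j" using card_Un_le[of "set p \<inter> A" "set q \<inter> (A - set p)"] p(4) q(4) by linarith
    finally show False using j by linarith
  qed
  define R where "R = X - A"
  have R: "finite R" "R \<subseteq> X" "R \<inter> A = {}" using assms(2) by (auto simp: R_def)
  have WR: "W \<subseteq> R" using AW by (auto simp: R_def joined_def)
  \<comment> \<open>The detour through \<open>a\<close> and a fresh vertex of \<open>W\<close>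
    reaches all of \<open>A\<close>. The length condition asks for two vertices in \<open>p\<close>
    if \<open>m\<close> is even but three if \<open>m\<close> is odd; this is why an edge joined to
    \<open>A\<close> survives only when all paths are odd.\<close>
  have attach: False
    if p: "is_path E p" "set p \<subseteq> R" "p \<noteq> []" "length p \<le> 3" "a \<in> A" "{last p, a} \<in> E"
      and m: "m \<in> set ms" "m \<ge> 4" "m + 2 \<le> length p + 2 * (m div 2)" for p a m
  proof -
    have "card W - card (set p) \<le> card (W - set p)" by (rule diff_card_le_card_Diff) simp
    then have "card (W - set p) > 0" using AW(5) p(4) card_length[of p] by linarith
    then obtain w where w: "w \<in> W" "w \<notin> set p" by (auto simp: card_gt_0_iff)
    have aw: "{a, w} \<in> E" "a \<noteq> w" using AW(3) w p(5) by (auto simp: joined_def)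
    have a: "a \<notin> set p" "w \<notin> A" using p R w WR by auto
    show False
    proof (rule extend[of "p @ [a, w]" m])
      show "is_path E (p @ [a, w])" using p w aw a by (intro is_path_appendI) auto
      show "set (p @ [a, w]) \<subseteq> X" using p w AW R by auto
      have "set (p @ [a, w]) \<inter> A = {a}" using p(2) R(3) a p(5) by auto
      then show "card (set (p @ [a, w]) \<inter> A) \<le> 1" by simp
      show "{last (p @ [a, w]), b} \<in> E" if "b \<in> A" for b
        using AW(3) that w by (auto simp: joined_def insert_commute)
    qed (use p m in auto)
  qed
  define s where "s v = card (nbrs E A v)" for v
  have sA: "s v \<le> card A" for v unfolding s_def by (rule card_nbrs_le[OF fA(1)])
  have full: "{v, a} \<in> E" if "s v = card A" "a \<in> A" for v a
  proof -
    have "nbrs E A v = A" using that(1) fA(1) nbrs_subset[of E A v]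
      by (intro card_subset_eq) (auto simp: s_def)
    then show ?thesis using that(2) by (auto simp: nbrs_def)
  qed
  have short: "length p \<le> 2 * (m0 div 2)" if p: "is_path E p" "set p \<subseteq> R" for p
  proof (rule ccontr)
    assume "\<not> ?thesis"
    then have "length p \<ge> m0" by presburger
    then have "length (take m0 p) = m0" by simp
    moreover have sub: "set (take m0 p) \<subseteq> R" using p(2) by (meson order_trans set_take_subset)
    ultimately have "m0 div 2 \<le> card (set (take m0 p) \<inter> A)" using R(2) p(1) m0(1)
      by (intro key is_path_take) auto
    moreover have "set (take m0 p) \<inter> A = {}" using sub R(3) by auto
    ultimately show False using m0(2) by simp
  qed
  have ends: "s (hd p) = 0" if p: "is_path E p" "set p \<subseteq> R" "3 \<le> length p" for p
  proof (rule ccontr)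
    assume "s (hd p) \<noteq> 0"
    then have "nbrs E A (hd p) \<noteq> {}" by (auto simp: s_def)
    then obtain a where a: "a \<in> A" "{hd p, a} \<in> E" by (auto simp: nbrs_def)
    obtain x y z q where pe: "p = x # y # z # q" using p(3)
      by (cases p; cases "tl p"; cases "tl (tl p)") auto
    show False
    proof (rule attach[of "rev [x, y, z]" a m1])
      have "is_path E [x, y, z]" using is_path_take[OF p(1), of 3] by (simp add: pe numeral_3_eq_3)
      then show "is_path E (rev [x, y, z])" by (simp only: is_path_rev)
      show "m1 + 2 \<le> length (rev [x, y, z]) + 2 * (m1 div 2)" by simp
    qed (use p a m1 in \<open>auto simp: pe\<close>)
  qed
  have bound: "(\<Sum>v\<in>Z. s v) + esize E Z \<le> card A * card Z"
    if Z: "Z \<subseteq> R" "\<And>u v. u \<in> Z \<Longrightarrow> v \<in> Z \<Longrightarrow> {u, v} \<in> E \<Longrightarrow> s u < card A \<or> s v < card A" for Z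
  proof (rule attached_deletion_bound[where l = "m0 div 2"])
    show "finite Z" using Z(1) R(1) finite_subset by auto
    show "2 * (m0 div 2) \<le> card A + 1" using m0(3) AW(4) by simp
    show "length p \<le> 2 * (m0 div 2)" if "is_path E p" "set p \<subseteq> Z" for p using short that Z(1) by auto
    show "s (hd p) = 0" if "is_path E p" "set p \<subseteq> Z" "3 \<le> length p" for p using ends that Z(1) by blast
  qed (use Z sA assms(1) in auto)
  have "esize E A = 0"
  proof -
    have "nbrs E A a = {}" if "a \<in> A" for a using indep that by (auto simp: nbrs_def)
    then show ?thesis using handshake[OF fA(1)] by simp
  qed
  then have eX: "esize E X = (\<Sum>v\<in>R. s v) + esize E R"
    using esize_split[OF assms(2) AW(1)] by (simp add: R_def s_def)
  show ?thesis
  proof (cases "\<forall>u\<in>R. \<forall>v\<in>R. {u, v} \<in> E \<longrightarrow> s u < card A \<or> s v < card A")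
    case True
    then show ?thesis using bound[of R] eX by (auto simp: R_def)
  next
    case False
    then obtain x y where xy: "x \<in> R" "y \<in> R" "{x, y} \<in> E" "s x = card A" "s y = card A"
      using sA by (metis le_neq_implies_less)
    have "x \<noteq> y" using xy(3) by auto
    have "1 \<le> m0 div 2" using m0(2) by simp
    then have "card A > 0" using m0(3) AW(4) by linarith
    then obtain a where a: "a \<in> A" by (auto simp: card_gt_0_iff)
    have odd: "odd m" if "m \<in> set ms" for m
    proof
      assume "even m"
      show False
      proof (rule attach[of "[y, x]" a m])
        show "{last [y, x], a} \<in> E" using full[OF xy(4) a] by simp
      qed (use xy \<open>x \<noteq> y\<close> a that \<open>even m\<close> even4 in \<open>auto simp: insert_commute\<close>)
    qed
    \<comment> \<open>A further neighbour \<open>w\<close> of \<open>u\<close> would give the path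
      \<open>[v, u, w]\<close> outside \<open>A\<close> that starts at a vertex with neighbours in
      \<open>A\<close>.\<close>
    have nb: "nbrs E R u \<subseteq> {u, v}" if "u \<in> R" "v \<in> R" "{u, v} \<in> E" "s v = card A" for u v
    proof
      fix w assume w: "w \<in> nbrs E R u"
      show "w \<in> {u, v}"
      proof (rule ccontr)
        assume "w \<notin> {u, v}"
        moreover have "u \<noteq> v" using that(3) by auto
        ultimately show False
          using w that ends[of "[v, u, w]"] \<open>card A > 0\<close> by (auto simp: nbrs_def insert_commute)
      qed
    qed
    let ?Z = "R - {x, y}"
    \<comment> \<open>A second edge \<open>{u, v}\<close> with both ends joined to all of
      \<open>A\<close> could be linked to \<open>{x, y}\<close> through one vertex of
      \<open>A\<close>, and the resulting path on five vertices can be extended.\<close>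
    have "(\<Sum>v\<in>?Z. s v) + esize E ?Z \<le> card A * card ?Z"
    proof (rule bound)
      fix u v assume uv: "u \<in> ?Z" "v \<in> ?Z" "{u, v} \<in> E"
      show "s u < card A \<or> s v < card A"
      proof (rule ccontr)
        assume "\<not> ?thesis"
        then have "s v = card A" using sA[of v] by linarith
        have "u \<noteq> v" using uv(3) by auto
        have nA: "x \<notin> A" "y \<notin> A" "u \<notin> A" "v \<notin> A" using xy uv R by auto
        show False
        proof (rule extend[of "[u, v, a, x, y]" m1])
          show "is_path E [u, v, a, x, y]"
            using uv xy a nA \<open>u \<noteq> v\<close> \<open>x \<noteq> y\<close> full[OF \<open>s v = card A\<close> a] full[OF xy(4) a]
            by (auto simp: insert_commute)
          have "set [u, v, a, x, y] \<inter> A = {a}" using nA a by auto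
          then show "card (set [u, v, a, x, y] \<inter> A) \<le> 1" by simp
          show "{last [u, v, a, x, y], b} \<in> E" if "b \<in> A" for b using full[OF xy(5) that] by simp
          show "m1 + 4 \<le> length [u, v, a, x, y] + 2 * (m1 div 2)" by simp
        qed (use uv xy a R AW m1 in auto)
      qed
    qed auto
    moreover have sub: "{x, y} \<subseteq> R" using xy by auto
    moreover have "esize E R = esize E ?Z + esize E {x, y}"
    proof (rule esize_remove_closed[OF R(1) sub])
      have "{y, x} \<in> E" using xy(3) by (simp add: insert_commute)
      then show "nbrs E R v \<subseteq> {x, y}" if "v \<in> {x, y}" for v
        using that nb[of x y] nb[of y x] xy by auto
    qed
    moreover have "esize E {x, y} \<le> 1" using esize_bound[of "{x, y}"] \<open>x \<noteq> y\<close> by simp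
    moreover have "(\<Sum>v\<in>R. s v) = (\<Sum>v\<in>?Z. s v) + 2 * card A"
      using sum_minus_subset[OF R(1) sub, of s] \<open>x \<noteq> y\<close> xy by simp
    moreover have "card R = card ?Z + 2" using card_minus_subset[OF R(1) sub] \<open>x \<noteq> y\<close> by simp
    then have "card A * card R = card A * card ?Z + 2 * card A" by (simp add: distrib_left)
    ultimately have "esize E X \<le> card A * card R + 1" using eX by linarith
    then have "esize E X \<le> card A * card (X - A) + 1" by (simp add: R_def)
    moreover have "\<forall>a\<in>A. {x, a} \<in> E \<and> {y, a} \<in> E" using full xy by blast
    ultimately show ?thesis using odd xy unfolding R_def by blast
  qed
qed

section \<open>Embeddings into concrete graphs\<close>

lemma wf_graph_sgraph: "wf_graph G \<Longrightarrow> sgraph (edges G)"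
  unfolding wf_graph_def by unfold_locales blast

lemma wf_graph_edge: "wf_graph G \<Longrightarrow> {u, v} \<in> edges G \<Longrightarrow> u \<noteq> v \<and> u \<in> verts G \<and> v \<in> verts G"
  unfolding wf_graph_def by (metis doubleton_eq_iff)

lemma wf_graph_finite: "wf_graph G \<Longrightarrow> finite (verts G)"
  by (simp add: wf_graph_def)

lemma card_edges: "wf_graph G \<Longrightarrow> card (edges G) = esize (edges G) (verts G)"
  unfolding esize_def wf_graph_def by (rule arg_cong[where f = card]) auto

lemma degree_eq_card_nbrs:
  assumes "wf_graph G"
  shows "degree G v = card (nbrs (edges G) (verts G) v)"
proof -
  have "{e \<in> edges G. v \<in> e} = (\<lambda>u. {v, u}) ` nbrs (edges G) (verts G) v"
  proof
    show "{e \<in> edges G. v \<in> e} \<subseteq> (\<lambda>u. {v, u}) ` nbrs (edges G) (verts G) v"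
    proof
      fix e assume e: "e \<in> {e \<in> edges G. v \<in> e}"
      then obtain x y where "e = {x, y}" "x \<in> verts G" "y \<in> verts G"
        using assms by (auto simp: wf_graph_def)
      with e show "e \<in> (\<lambda>u. {v, u}) ` nbrs (edges G) (verts G) v"
        by (auto simp: nbrs_def insert_commute image_iff)
    qed
  qed (auto simp: nbrs_def)
  moreover have "inj_on (\<lambda>u. {v, u}) A" for A by (auto simp: inj_on_def doubleton_eq_iff)
  ultimately show ?thesis by (simp add: degree_def card_image)
qed

lemma successively_upt:
  "(\<And>t. t + 1 < m \<Longrightarrow> P t (t + 1)) \<Longrightarrow> successively P [0..<m]"
proof (induction m)
  case (Suc m)
  have "P (last [0..<m]) m" if "m > 0" using Suc.prems[of "m - 1"] that by (simp add: last_upt)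
  with Suc show ?case by (cases "m = 0") (auto simp: successively_append_iff)
qed simp

text \<open>In \<open>path_forest\<close> the paths occupy consecutive intervals, so removing the
  first path amounts to the shift \<open>\<lambda>x. f (m + x)\<close>.\<close>

lemma embedding_has_forest:
  assumes "inj_on f {0..<sum_list ms}" "f ` {0..<sum_list ms} \<subseteq> X"
    "\<And>i t. i < length ms \<Longrightarrow> t + 1 < ms ! i \<Longrightarrow>
       {f (sum_list (take i ms) + t), f (sum_list (take i ms) + t + 1)} \<in> E"
  shows "has_forest E X ms"
  using assms
proof (induction ms arbitrary: f X)
  case (Cons m ms)
  define p where "p = map f [0..<m]"
  have inj: "inj_on f {0..<m}" using Cons.prems(1) by (rule inj_on_subset) auto
  have "successively (\<lambda>u v. {u, v} \<in> E) p" unfolding p_def successively_map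
    using Cons.prems(3)[of 0] by (intro successively_upt) auto
  then have "is_path E p" using inj by (simp add: is_path_def p_def distinct_map)
  moreover have "set p \<subseteq> X" using Cons.prems(2) by (force simp: p_def)
  moreover have "has_forest E (X - set p) ms"
  proof (rule Cons.IH[of "\<lambda>x. f (m + x)"])
    show "inj_on (\<lambda>x. f (m + x)) {0..<sum_list ms}"
    proof (rule inj_onI)
      fix x y assume "x \<in> {0..<sum_list ms}" "y \<in> {0..<sum_list ms}" "f (m + x) = f (m + y)"
      then show "x = y" using inj_onD[OF Cons.prems(1), of "m + x" "m + y"] by simp
    qed
    show "(\<lambda>x. f (m + x)) ` {0..<sum_list ms} \<subseteq> X - set p"
    proof
      fix z assume "z \<in> (\<lambda>x. f (m + x)) ` {0..<sum_list ms}"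
      then obtain x where x: "x < sum_list ms" "z = f (m + x)" by auto
      have "z \<in> X" using Cons.prems(2) x by (auto simp: image_subset_iff)
      moreover have "z \<noteq> f y" if "y < m" for y
        using inj_onD[OF Cons.prems(1), of "m + x" y] x that by auto
      ultimately show "z \<in> X - set p" unfolding p_def set_map set_upt by (meson DiffI atLeastLessThan_iff imageE)
    qed
    show "{f (m + (sum_list (take i ms) + t)), f (m + (sum_list (take i ms) + t + 1))} \<in> E"
      if "i < length ms" "t + 1 < ms ! i" for i t
      using Cons.prems(3)[of "Suc i" t] that by (simp add: add.assoc)
  qed
  moreover have "length p = m" by (simp add: p_def)
  ultimately show ?case by auto
qed simp

lemma has_forest_embedding:
  assumes "has_forest E X ms"
  shows "\<exists>f. inj_on f {0..<sum_list ms} \<and> f ` {0..<sum_list ms} \<subseteq> X \<and>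
    (\<forall>i t. i < length ms \<longrightarrow> t + 1 < ms ! i \<longrightarrow>
       {f (sum_list (take i ms) + t), f (sum_list (take i ms) + t + 1)} \<in> E)"
  using assms
proof (induction ms arbitrary: X)
  case (Cons m ms)
  from Cons.prems obtain p where p: "is_path E p" "set p \<subseteq> X" "length p = m"
    "has_forest E (X - set p) ms" by auto
  from Cons.IH[OF p(4)] obtain g where g: "inj_on g {0..<sum_list ms}"
    "g ` {0..<sum_list ms} \<subseteq> X - set p"
    "\<And>i t. i < length ms \<Longrightarrow> t + 1 < ms ! i \<Longrightarrow>
       {g (sum_list (take i ms) + t), g (sum_list (take i ms) + t + 1)} \<in> E" by blast
  define f where "f x = (if x < m then p ! x else g (x - m))" for x
  have gX: "g x \<in> X" "g x \<notin> set p" if "x < sum_list ms" for x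
    using g(2) that by (auto simp: image_subset_iff)
  have pX: "p ! x \<in> set p" if "x < m" for x using that p(3) by simp
  have "inj_on f {0..<m + sum_list ms}"
  proof (rule inj_onI)
    fix x y assume xy: "x \<in> {0..<m + sum_list ms}" "y \<in> {0..<m + sum_list ms}" "f x = f y"
    have "distinct p" using p by (simp add: is_path_def)
    consider "x < m" "y < m" | "x < m" "y \<ge> m" | "x \<ge> m" "y < m" | "x \<ge> m" "y \<ge> m" by linarith
    then show "x = y"
    proof cases
      case 1
      then show ?thesis using xy \<open>distinct p\<close> p(3) by (simp add: f_def nth_eq_iff_index_eq)
    next
      case 2
      then have "g (y - m) \<in> set p" using xy pX[of x] by (simp add: f_def)
      moreover have "y - m < sum_list ms" using xy(2) 2 by simp
      ultimately show ?thesis using gX(2) by blast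
    next
      case 3
      then have "g (x - m) \<in> set p" using xy pX[of y] by (simp add: f_def)
      moreover have "x - m < sum_list ms" using xy(1) 3 by simp
      ultimately show ?thesis using gX(2) by blast
    next
      case 4
      then have "x - m = y - m" using xy by (intro inj_onD[OF g(1)]) (auto simp: f_def)
      then show ?thesis using 4 by simp
    qed
  qed
  moreover have "f ` {0..<m + sum_list ms} \<subseteq> X"
    using gX(1) pX p(2) by (auto simp: f_def)
  moreover have "{f (sum_list (take i (m # ms)) + t), f (sum_list (take i (m # ms)) + t + 1)} \<in> E"
    if "i < length (m # ms)" "t + 1 < (m # ms) ! i" for i t
  proof (cases i)
    case 0
    have "{p ! t, p ! (t + 1)} \<in> E"
    proof -
      have "p = take t p @ p ! t # p ! Suc t # drop (Suc (Suc t)) p"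
        using that 0 p(3) by (simp add: Cons_nth_drop_Suc)
      then have "is_path E (take t p @ p ! t # p ! Suc t # drop (Suc (Suc t)) p)" using p(1) by simp
      then have "is_path E (p ! t # p ! Suc t # drop (Suc (Suc t)) p)" by (rule is_path_appendD)
      then show ?thesis by simp
    qed
    then show ?thesis using that 0 by (simp add: f_def)
  next
    case (Suc j)
    then show ?thesis using g(3)[of j t] that by (simp add: f_def add.assoc)
  qed
  ultimately show ?case by (intro exI[of _ f]) auto
qed auto

lemma contains_path_forest:
  "contains G (path_forest ms) \<longleftrightarrow> has_forest (edges G) (verts G) ms"
proof
  assume "contains G (path_forest ms)"
  then obtain f where f: "inj_on f {0..<sum_list ms}" "f ` {0..<sum_list ms} \<subseteq> verts G"
    "\<forall>e\<in>edges (path_forest ms). f ` e \<in> edges G"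
    unfolding contains_def by (auto simp: path_forest_def verts_def)
  show "has_forest (edges G) (verts G) ms"
  proof (rule embedding_has_forest[OF f(1,2)])
    fix i t assume "i < length ms" "t + 1 < ms ! i"
    then have "{sum_list (take i ms) + t, sum_list (take i ms) + t + 1} \<in> edges (path_forest ms)"
      unfolding path_forest_def edges_def by auto
    with f(3) show "{f (sum_list (take i ms) + t), f (sum_list (take i ms) + t + 1)} \<in> edges G"
      by fastforce
  qed
next
  assume "has_forest (edges G) (verts G) ms"
  from has_forest_embedding[OF this] obtain f where f: "inj_on f {0..<sum_list ms}"
    "f ` {0..<sum_list ms} \<subseteq> verts G"
    "\<And>i t. i < length ms \<Longrightarrow> t + 1 < ms ! i \<Longrightarrow>
       {f (sum_list (take i ms) + t), f (sum_list (take i ms) + t + 1)} \<in> edges G" by blast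
  then show "contains G (path_forest ms)"
    unfolding contains_def by (intro exI[of _ f]) (auto simp: path_forest_def verts_def edges_def)
qed

section \<open>Graphs whose edges all meet one fixed edge\<close>

lemma beta1_one_edge:
  assumes "beta1 F = 1" "wf_graph F"
  obtains u1 u2 where "u1 \<noteq> u2" "edge_control_set F {{u1, u2}}"
proof -
  have "\<exists>m E'. edge_control_set F E' \<and> card E' = m"
    by (intro exI[of _ "card (edges F)"] exI[of _ "edges F"]) (auto simp: edge_control_set_def)
  then have "\<exists>E'. edge_control_set F E' \<and> card E' = beta1 F"
    unfolding beta1_def by (rule LeastI_ex)
  then obtain e where e: "edge_control_set F {e}" using assms(1) by (auto simp: card_1_singleton_iff)
  then have "e \<in> edges F" by (simp add: edge_control_set_def)
  then obtain u v where "u \<noteq> v" "e = {u, v}" using assms(2) by (auto simp: wf_graph_def)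
  with e that show thesis by auto
qed

lemma not_2_colorable: "chromatic_number F \<ge> 3 \<Longrightarrow> \<not> colorable F 2"
  using Least_le[of "colorable F" 2] by (auto simp: chromatic_number_def)

text \<open>Such a graph is an edge \<open>{u1, u2}\<close> together with pairwise nonadjacent
  vertices, each attached to one or both ends. The ends play symmetric roles, so \<open>swap\<close>
  lets each argument be written for one of them.\<close>

locale controlled_graph =
  fixes F :: ugraph and u1 u2 :: nat
  assumes wf: "wf_graph F" and noiso: "no_isolated F" and chi: "chromatic_number F \<ge> 3"
    and u12: "u1 \<noteq> u2" and control: "edge_control_set F {{u1, u2}}"
begin

lemma swap: "controlled_graph F u2 u1"
  using wf noiso chi u12 control by unfold_locales (auto simp: insert_commute)

lemma base_edge: "{u1, u2} \<in> edges F"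
  using control by (simp add: edge_control_set_def)

lemma edge_cases:
  assumes "{x, y} \<in> edges F"
  shows "x = u1 \<or> x = u2 \<or> y = u1 \<or> y = u2"
proof (cases "{x, y} = {u1, u2}")
  case False
  then have "{x, y} \<inter> {u1, u2} \<noteq> {}" using control assms unfolding edge_control_set_def by blast
  then show ?thesis by blast
qed (auto simp: doubleton_eq_iff)

lemma other_adjacent:
  assumes "v \<in> verts F" "v \<noteq> u1" "v \<noteq> u2"
  shows "{u1, v} \<in> edges F \<or> {u2, v} \<in> edges F"
proof -
  obtain e where e: "e \<in> edges F" "v \<in> e" using noiso assms(1) by (auto simp: no_isolated_def)
  then obtain x y where "e = {x, y}" using wf by (auto simp: wf_graph_def)
  then obtain w where "{w, v} \<in> edges F" using e by (metis empty_iff insert_commute insert_iff)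
  then show ?thesis using edge_cases[of w v] assms(2,3) by blast
qed

text \<open>Otherwise the neighbours of \<open>u1\<close>, among them \<open>u2\<close>, and their
  complement would both be independent, against the chromatic number.\<close>

lemma common_neighbour: "\<exists>w. w \<noteq> u1 \<and> w \<noteq> u2 \<and> {u1, w} \<in> edges F \<and> {u2, w} \<in> edges F"
proof (rule ccontr)
  assume no: "\<not> ?thesis"
  define col where "col v = (if v = u2 \<or> v \<noteq> u1 \<and> {u1, v} \<in> edges F then 1 else 0 :: nat)" for v
  have "col x \<noteq> col y" if "{x, y} \<in> edges F" for x y
    using edge_cases[OF that] that wf_graph_edge[OF wf that] no u12
    unfolding col_def by (auto simp: insert_commute)
  then have "colorable F 2" unfolding colorable_def by (intro exI[of _ col]) (auto simp: col_def)
  then show False using not_2_colorable[OF chi] by simp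
qed

lemma embed:
  assumes "x1 \<in> verts G" "x2 \<in> verts G" "{x1, x2} \<in> edges G" "x1 \<noteq> x2"
    and g: "inj_on g (verts F - {u1, u2})" "g ` (verts F - {u1, u2}) \<subseteq> verts G - {x1, x2}"
    and adj: "\<And>w. w \<in> verts F - {u1, u2} \<Longrightarrow> {u1, w} \<in> edges F \<Longrightarrow> {x1, g w} \<in> edges G"
      "\<And>w. w \<in> verts F - {u1, u2} \<Longrightarrow> {u2, w} \<in> edges F \<Longrightarrow> {x2, g w} \<in> edges G"
  shows "contains G F"
proof -
  define f where "f v = (if v = u1 then x1 else if v = u2 then x2 else g v)" for v
  have gv: "g v \<in> verts G" "g v \<noteq> x1" "g v \<noteq> x2" if "v \<in> verts F" "v \<noteq> u1" "v \<noteq> u2" for v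
    using g(2) that by auto
  have "inj_on f (verts F)"
  proof (rule inj_onI)
    fix x y assume xy: "x \<in> verts F" "y \<in> verts F" "f x = f y"
    show "x = y"
    proof (cases "x \<in> {u1, u2} \<or> y \<in> {u1, u2}")
      case True
      then show ?thesis using xy gv[of x] gv[of y] assms(4) u12 by (auto simp: f_def split: if_splits)
    next
      case False
      then show ?thesis using xy inj_onD[OF g(1), of x y] by (auto simp: f_def)
    qed
  qed
  moreover have "f ` verts F \<subseteq> verts G" using gv assms by (auto simp: f_def)
  moreover have "f ` e \<in> edges G" if "e \<in> edges F" for e
  proof -
    have one: "{f u1, f w} \<in> edges G" if "{u1, w} \<in> edges F" for w
      using wf_graph_edge[OF wf that] adj(1)[of w] that assms(3) by (auto simp: f_def)
    have two: "{f u2, f w} \<in> edges G" if "{u2, w} \<in> edges F" for w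
      using wf_graph_edge[OF wf that] adj(2)[of w] that assms(3) u12
      by (auto simp: f_def insert_commute)
    obtain x y where e: "e = {x, y}" using sgraph.edgeE[OF wf_graph_sgraph[OF wf] \<open>e \<in> edges F\<close>] by auto
    have xy: "{x, y} \<in> edges F" "{y, x} \<in> edges F" using e that by (auto simp: insert_commute)
    have "f ` e = {f x, f y}" "f ` e = {f y, f x}" using e by auto
    with edge_cases[OF xy(1)] one[of x] one[of y] two[of x] two[of y] xy show ?thesis by metis
  qed
  ultimately show ?thesis unfolding contains_def by blast
qed

lemma u_verts: "u1 \<in> verts F" "u2 \<in> verts F"
  using wf_graph_edge[OF wf base_edge] by auto

lemma card_rest: "card (verts F) = card (verts F - {u1, u2}) + 2"
  using card_minus_subset[OF wf_graph_finite[OF wf], of "{u1, u2}"] u_verts u12 by simp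

text \<open>Applied to an edge inside the core, with \<open>W\<close> as common neighbours: each
  remaining vertex of \<open>F\<close> needs only \<open>a\<close> or \<open>b\<close>, so any
  injection into \<open>W\<close> works. This makes the core independent.\<close>

lemma embed_book:
  assumes "wf_graph G" "{a, b} \<in> edges G" "joined (edges G) {a, b} W" "W \<subseteq> verts G"
    and "card (verts F) \<le> card W"
  shows "contains G F"
proof -
  have "card (verts F - {u1, u2}) \<le> card W" using assms(5) card_rest by linarith
  moreover have "finite W" using assms(1,4) wf_graph_finite finite_subset by metis
  ultimately obtain g where g: "inj_on g (verts F - {u1, u2})" "g ` (verts F - {u1, u2}) \<subseteq> W"
    using card_le_inj[of "verts F - {u1, u2}" W] wf_graph_finite[OF wf] by auto
  show ?thesis
  proof (rule embed[of a G b g])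
    show "g ` (verts F - {u1, u2}) \<subseteq> verts G - {a, b}"
      using g(2) assms(3,4) unfolding joined_def by blast
  qed (use assms wf_graph_edge[OF assms(1,2)] g in \<open>auto simp: joined_def\<close>)
qed

text \<open>The role of condition (2): for the exceptional edge \<open>{x, y}\<close> outside the
  core, the only guaranteed common neighbours are the l - 1 vertices of \<open>A\<close>, which hold
  \<open>F\<close> when it has at most l + 1 vertices.\<close>

lemma embed_small:
  assumes "wf_graph G" "{x, y} \<in> edges G" "joined (edges G) {x, y} A" "A \<subseteq> verts G"
    and "card (verts F) \<le> card A + 2"
  shows "contains G F"
proof -
  have "card (verts F - {u1, u2}) \<le> card A" using assms(5) card_rest by linarith
  moreover have "finite A" using assms(1,4) wf_graph_finite finite_subset by metis
  ultimately obtain g where g: "inj_on g (verts F - {u1, u2})" "g ` (verts F - {u1, u2}) \<subseteq> A"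
    using card_le_inj[of "verts F - {u1, u2}" A] wf_graph_finite[OF wf] by auto
  show ?thesis
  proof (rule embed[of x G y g])
    show "g ` (verts F - {u1, u2}) \<subseteq> verts G - {x, y}"
      using g(2) assms(3,4) unfolding joined_def by blast
  qed (use assms wf_graph_edge[OF assms(1,2)] g in \<open>auto simp: joined_def\<close>)
qed

text \<open>A triangle containing at most one of \<open>u1\<close>, \<open>u2\<close> would have an
  edge avoiding both.\<close>

lemma triangle_iff:
  "{T. \<exists>a b c. T = {a, b, c} \<and> a \<noteq> b \<and> a \<noteq> c \<and> b \<noteq> c \<and>
        {a, b} \<in> edges F \<and> {a, c} \<in> edges F \<and> {b, c} \<in> edges F} =
   (\<lambda>w. {u1, u2, w}) ` {w. {u1, w} \<in> edges F \<and> {u2, w} \<in> edges F}" (is "?L = ?R")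
proof
  show "?L \<subseteq> ?R"
  proof
    fix T assume "T \<in> ?L"
    then obtain a b c where T: "T = {a, b, c}" "a \<noteq> b" "a \<noteq> c" "b \<noteq> c"
      "{a, b} \<in> edges F" "{a, c} \<in> edges F" "{b, c} \<in> edges F" by blast
    note ec = edge_cases[OF T(5)] edge_cases[OF T(6)] edge_cases[OF T(7)]
    consider "{a, b} = {u1, u2}" | "{a, c} = {u1, u2}" | "{b, c} = {u1, u2}"
      using ec T(2-4) by blast
    then show "T \<in> ?R"
    proof cases
      case 1
      then have "T = {u1, u2, c}" using T(1) by auto
      moreover have "{u1, c} \<in> edges F" "{u2, c} \<in> edges F"
        using T 1 by (auto simp: doubleton_eq_iff)
      ultimately show ?thesis by auto
    next
      case 2
      then have "T = {u1, u2, b}" using T(1) by auto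
      moreover have "{u1, b} \<in> edges F" "{u2, b} \<in> edges F"
        using T 2 by (auto simp: doubleton_eq_iff insert_commute)
      ultimately show ?thesis by auto
    next
      case 3
      then have "T = {u1, u2, a}" using T(1) by auto
      moreover have "{u1, a} \<in> edges F" "{u2, a} \<in> edges F"
        using T 3 by (auto simp: doubleton_eq_iff insert_commute)
      ultimately show ?thesis by auto
    qed
  qed
  show "?R \<subseteq> ?L"
  proof
    fix T assume "T \<in> ?R"
    then obtain w where w: "T = {u1, u2, w}" "{u1, w} \<in> edges F" "{u2, w} \<in> edges F" by auto
    then show "T \<in> ?L" using base_edge u12 wf_graph_edge[OF wf] by blast
  qed
qed

lemma num_triangles_eq:
  "num_triangles F = card {w. {u1, w} \<in> edges F \<and> {u2, w} \<in> edges F}"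
proof -
  have "inj_on (\<lambda>w. {u1, u2, w}) {w. {u1, w} \<in> edges F \<and> {u2, w} \<in> edges F}"
  proof (rule inj_onI)
    fix x y assume "x \<in> {w. {u1, w} \<in> edges F \<and> {u2, w} \<in> edges F}"
      "y \<in> {w. {u1, w} \<in> edges F \<and> {u2, w} \<in> edges F}" "{u1, u2, x} = {u1, u2, y}"
    moreover from this have "x \<noteq> u1" "x \<noteq> u2" "y \<noteq> u1" "y \<noteq> u2" using wf_graph_edge[OF wf] by blast+
    ultimately show "x = y" by blast
  qed
  then show ?thesis unfolding num_triangles_def triangle_iff by (rule card_image)
qed

text \<open>The role of condition (3): now \<open>u1\<close> goes to a core vertex \<open>a\<close>,
  \<open>u2\<close> to \<open>x\<close> and the apex of the triangle to \<open>y\<close>. The other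
  neighbours of \<open>u1\<close> find ample room in \<open>W\<close>, but those of
  \<open>u2\<close> must fit into \<open>A - {a}\<close>. There are \<open>degree F u2 - 2\<close>
  of them, whence the bound \<open>card A + 1\<close>, which is l.\<close>

lemma embed_unique_triangle:
  assumes G: "wf_graph G" "{x, y} \<in> edges G" "joined (edges G) {x, y} A" "A \<subseteq> verts G" "A \<noteq> {}"
    and W: "joined (edges G) A W" "W \<subseteq> verts G" "card (verts F) + 2 \<le> card W"
    and t: "num_triangles F = 1" and d: "degree F u2 \<le> card A + 1"
  shows "contains G F"
proof -
  obtain a where a: "a \<in> A" using G(5) by auto
  have fin: "finite A" "finite W" "finite (verts F)"
    using G(1,4) W(2) wf_graph_finite[OF wf] wf_graph_finite[OF G(1)] finite_subset by auto
  obtain w0 where w0: "{w. {u1, w} \<in> edges F \<and> {u2, w} \<in> edges F} = {w0}"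
    using card_1_singletonE[of "{w. {u1, w} \<in> edges F \<and> {u2, w} \<in> edges F}"] t
    unfolding num_triangles_eq by blast
  then have w0e: "{u1, w0} \<in> edges F" "{u2, w0} \<in> edges F" by blast+
  note w0v = wf_graph_edge[OF wf w0e(1)] wf_graph_edge[OF wf w0e(2)]
  define B1 where "B1 = nbrs (edges F) (verts F) u1 - {u2, w0}"
  define B2 where "B2 = nbrs (edges F) (verts F) u2 - {u1, w0}"
  have fB: "finite B1" "finite B2" using fin(3) by (auto simp: B1_def B2_def)
  have "{u1, w0} \<subseteq> nbrs (edges F) (verts F) u2"
    using base_edge w0e w0v u_verts by (auto simp: nbrs_def insert_commute)
  then have "degree F u2 = card B2 + 2"
    using card_minus_subset[of "nbrs (edges F) (verts F) u2" "{u1, w0}"] fin(3) w0v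
    by (simp add: degree_eq_card_nbrs[OF wf] B2_def)
  then have "card B2 \<le> card (A - {a})" using d a by simp
  then obtain g2 where g2: "inj_on g2 B2" "g2 ` B2 \<subseteq> A - {a}"
    using card_le_inj[of B2 "A - {a}"] fB fin by auto
  have "card B1 \<le> card (verts F)" unfolding B1_def using fin(3) by (intro card_mono) (auto simp: nbrs_def)
  moreover have "card W - card {x, y} \<le> card (W - {x, y})" by (rule diff_card_le_card_Diff) simp
  moreover have "card {x, y} \<le> 2" by (simp add: card_insert_if)
  ultimately have "card B1 \<le> card (W - {x, y})" using W(3) by linarith
  then obtain g1 where g1: "inj_on g1 B1" "g1 ` B1 \<subseteq> W - {x, y}"
    using card_le_inj[of B1 "W - {x, y}"] fB fin by auto
  have disj: "B1 \<inter> B2 = {}" using w0 by (auto simp: B1_def B2_def nbrs_def)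
  have rest: "verts F - {u1, u2} = insert w0 (B1 \<union> B2)"
    using other_adjacent w0v wf_graph_edge[OF wf] by (auto simp: B1_def B2_def nbrs_def)
  define g where "g v = (if v = w0 then y else if v \<in> B1 then g1 v else g2 v)" for v
  have xy: "x \<noteq> y" "x \<in> verts G" "y \<in> verts G" using wf_graph_edge[OF G(1,2)] by auto
  have nA: "x \<notin> A" "y \<notin> A" using G(3) by (auto simp: joined_def)
  have nW: "w \<notin> A" if "w \<in> W" for w using W(1) that by (auto simp: joined_def)
  have w0B: "w0 \<notin> B1" "w0 \<notin> B2" by (auto simp: B1_def B2_def)
  have gB1: "g v \<in> W - {x, y}" if "v \<in> B1" for v using that g1(2) w0B by (auto simp: g_def)
  have gB2: "g v \<in> A - {a}" if "v \<in> B2" for v using that g2(2) w0B disj by (auto simp: g_def)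
  have gw0: "g w0 = y" by (simp add: g_def)
  show ?thesis
  proof (rule embed[of a G x g])
    show "a \<in> verts G" "x \<in> verts G" "a \<noteq> x" using a G(4) xy nA by auto
    show "{a, x} \<in> edges G" using G(3) a by (auto simp: joined_def insert_commute)
    have "inj_on g B1" using g1(1) w0B by (rule_tac inj_on_cong[THEN iffD1, of B1 g1]) (auto simp: g_def)
    moreover have "inj_on g B2"
      using g2(1) w0B disj by (rule_tac inj_on_cong[THEN iffD1, of B2 g2]) (auto simp: g_def)
    moreover have "g ` B1 \<inter> g ` B2 = {}" using gB1 gB2 nW by fastforce
    ultimately have "inj_on g (B1 \<union> B2)" using disj by (auto simp: inj_on_Un)
    moreover have "g w0 \<notin> g ` (B1 \<union> B2)" using gB1 gB2 nA gw0 by fastforce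
    ultimately show "inj_on g (verts F - {u1, u2})" unfolding rest using w0B by (auto simp: inj_on_insert)
    show "g ` (verts F - {u1, u2}) \<subseteq> verts G - {a, x}"
    proof
      fix z assume "z \<in> g ` (verts F - {u1, u2})"
      then obtain v where v: "v = w0 \<or> v \<in> B1 \<or> v \<in> B2" "z = g v" unfolding rest by auto
      then show "z \<in> verts G - {a, x}"
        using gB1[of v] gB2[of v] gw0 xy nA nW[of z] a G(4) W(2) by auto
    qed
    show "{a, g w} \<in> edges G" if w: "w \<in> verts F - {u1, u2}" "{u1, w} \<in> edges F" for w
    proof (cases "w = w0")
      case True
      then show ?thesis using gw0 G(3) a by (auto simp: joined_def insert_commute)
    next
      case False
      then have "w \<in> B1" using w by (auto simp: B1_def nbrs_def)
      then show ?thesis using gB1[of w] W(1) a by (auto simp: joined_def)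
    qed
    show "{x, g w} \<in> edges G" if w: "w \<in> verts F - {u1, u2}" "{u2, w} \<in> edges F" for w
    proof (cases "w = w0")
      case True
      then show ?thesis using gw0 G(2) by simp
    next
      case False
      then have "w \<in> B2" using w by (auto simp: B2_def nbrs_def)
      then show ?thesis using gB2[of w] G(3) by (auto simp: joined_def)
    qed
  qed
qed

end

lemma f_val_set_finite:
  assumes "wf_graph F"
  shows "finite {min (degree F u1) (degree F u2) | u1 u2. u1 \<noteq> u2 \<and> edge_control_set F {{u1, u2}}}"
proof (rule finite_subset)
  show "{min (degree F u1) (degree F u2) | u1 u2. u1 \<noteq> u2 \<and> edge_control_set F {{u1, u2}}}
     \<subseteq> (\<lambda>(u1, u2). min (degree F u1) (degree F u2)) ` (verts F \<times> verts F)"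
  proof (clarsimp simp: image_iff)
    fix u1 u2 assume "edge_control_set F {{u1, u2}}"
    then have "{u1, u2} \<in> edges F" by (simp add: edge_control_set_def)
    from wf_graph_edge[OF assms this]
    show "\<exists>x\<in>verts F. \<exists>y\<in>verts F. min (degree F u1) (degree F u2) = min (degree F x) (degree F y)" by blast
  qed
  show "finite ((\<lambda>(u1, u2). min (degree F u1) (degree F u2)) ` (verts F \<times> verts F))"
    using assms by (simp add: wf_graph_finite)
qed

text \<open>A control edge attaining the minimum is oriented so that \<open>u2\<close> is the end of
  smaller degree, the one whose neighbours must be placed in the core.\<close>

lemma f_val_attained:
  assumes "wf_graph F" "no_isolated F" "chromatic_number F \<ge> 3" "beta1 F = 1"
  obtains u1 u2 where "controlled_graph F u1 u2" "f_val F = degree F u2"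
proof -
  let ?S = "{min (degree F u1) (degree F u2) | u1 u2. u1 \<noteq> u2 \<and> edge_control_set F {{u1, u2}}}"
  obtain v1 v2 where "v1 \<noteq> v2" "edge_control_set F {{v1, v2}}" using beta1_one_edge[OF assms(4,1)] .
  then have "?S \<noteq> {}" by blast
  then have "f_val F \<in> ?S" unfolding f_val_def using f_val_set_finite[OF assms(1)] Min_in by blast
  then obtain u1 u2 where u: "f_val F = min (degree F u1) (degree F u2)" "u1 \<noteq> u2"
    "edge_control_set F {{u1, u2}}" by blast
  interpret controlled_graph F u1 u2 using assms u by unfold_locales auto
  show thesis
  proof (cases "degree F u1 \<le> degree F u2")
    case True
    then show thesis using that[OF swap] u(1) by simp
  next
    case False
    then show thesis using that[OF controlled_graph_axioms] u(1) by simp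
  qed
qed

section \<open>Extremal graphs and the theorem\<close>

lemma is_path_restrict:
  assumes "is_path E p" "\<And>e. e \<in> E \<Longrightarrow> e \<subseteq> set p \<Longrightarrow> e \<in> E'"
  shows "is_path E' p"
proof -
  have "successively (\<lambda>u v. {u, v} \<in> E) p" using assms(1) by (simp add: is_path_def)
  then have "successively (\<lambda>u v. {u, v} \<in> E') p"
    by (rule successively_mono) (use assms(2) in auto)
  then show ?thesis using assms(1) by (simp add: is_path_def)
qed

text \<open>Consecutive disjoint pairs of vertices form a matching of \<open>length p div 2\<close>
  edges, each of which meets \<open>A\<close>.\<close>

lemma path_cover:
  assumes "is_path E p" "\<And>e. e \<in> E \<Longrightarrow> e \<inter> A \<noteq> {}"
  shows "length p div 2 \<le> card (A \<inter> set p)"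
  using assms(1)
proof (induction p rule: induct_list012)
  case (3 x y q)
  have q: "is_path E q" using is_path_appendD(2)[of E "[x, y]" q] "3.prems" by simp
  have "{x, y} \<in> E" using "3.prems" by simp
  then obtain z where z: "z \<in> {x, y}" "z \<in> A" using assms(2)[of "{x, y}"] by auto
  then have "z \<notin> set q" using "3.prems" by (auto simp: is_path_def)
  then have "Suc (card (A \<inter> set q)) = card (insert z (A \<inter> set q))" by simp
  also have "\<dots> \<le> card (A \<inter> set (x # y # q))" using z by (intro card_mono) auto
  finally show ?case using "3.IH"(1)[OF q] by simp
qed simp_all

text \<open>A path of odd order that loses one edge splits into two paths, one of even and one of odd order,
  so its vertex cover number does not drop.\<close>
lemma path_cover_odd:
  assumes "is_path (insert {x, y} E) p" "odd (length p)" "\<And>e. e \<in> E \<Longrightarrow> e \<inter> A \<noteq> {}"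
  shows "length p div 2 \<le> card (A \<inter> set p)"
proof (cases "\<exists>us vs. p = us @ vs \<and> us \<noteq> [] \<and> vs \<noteq> [] \<and> {last us, hd vs} = {x, y}")
  case False
  have "is_path E q" if "\<exists>r. p = r @ q" for q
    using that
  proof (induction q)
    case (Cons a q)
    then have "is_path E q" by (metis append.assoc append_Cons append_Nil)
    moreover have "a \<notin> set q" using Cons.prems assms(1) by (auto simp: is_path_def)
    moreover have "{a, hd q} \<in> E" if "q \<noteq> []"
    proof -
      obtain r where r: "p = (r @ [a]) @ q" using Cons.prems by auto
      have "{last (r @ [a]), hd q} \<in> insert {x, y} E"
        using is_path_appendD(4)[of _ "r @ [a]" q] assms(1) that r by auto
      moreover have "{last (r @ [a]), hd q} \<noteq> {x, y}" using False r that by blast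
      ultimately show ?thesis by simp
    qed
    ultimately show ?case by (intro is_path_ConsI)
  qed simp
  then have "is_path E p" by blast
  then show ?thesis using assms(3) by (rule path_cover)
next
  case True
  then obtain us vs where p: "p = us @ vs" "us \<noteq> []" "vs \<noteq> []" "{last us, hd vs} = {x, y}" by blast
  have parts: "is_path (insert {x, y} E) us" "is_path (insert {x, y} E) vs" "set us \<inter> set vs = {}"
    using is_path_appendD[of _ us vs] assms(1) p(1) by blast+
  have "last us \<in> set us" "hd vs \<in> set vs" using p by auto
  then have "\<not> {x, y} \<subseteq> set us" "\<not> {x, y} \<subseteq> set vs" using parts(3) p(4) by blast+
  then have "is_path E us" "is_path E vs" using is_path_restrict parts(1,2) by blast+
  then have "length us div 2 \<le> card (A \<inter> set us)" "length vs div 2 \<le> card (A \<inter> set vs)"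
    using path_cover[OF _ assms(3)] by blast+
  moreover have "card (A \<inter> set p) = card (A \<inter> set us) + card (A \<inter> set vs)"
    using parts(3) by (subst card_Un_disjoint[symmetric]) (auto simp: p(1) Int_Un_distrib)
  moreover have "length p div 2 \<le> length us div 2 + length vs div 2"
    using assms(2) p(1) by simp presburger
  ultimately show ?thesis by linarith
qed

lemma forest_cover:
  assumes "has_forest E X ms" "finite A"
    "\<And>p. is_path E p \<Longrightarrow> length p \<in> set ms \<Longrightarrow> length p div 2 \<le> card (A \<inter> set p)"
  shows "halves ms \<le> card (A \<inter> X)"
  using assms(1,3)
proof (induction ms arbitrary: X)
  case (Cons m ms)
  from Cons.prems(1) obtain p where p: "is_path E p" "set p \<subseteq> X" "length p = m"
    "has_forest E (X - set p) ms" by auto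
  have "halves ms \<le> card (A \<inter> (X - set p))" using p(4) Cons.prems(2) by (intro Cons.IH) auto
  moreover have "m div 2 \<le> card (A \<inter> set p)" using Cons.prems(2)[OF p(1)] p(3) by simp
  moreover have "A \<inter> X = (A \<inter> set p) \<union> (A \<inter> (X - set p))" using p(2) by auto
  then have "card (A \<inter> X) = card (A \<inter> set p) + card (A \<inter> (X - set p))"
    using assms(2) by (simp only:) (intro card_Un_disjoint, auto)
  ultimately show ?case by simp
qed simp

section \<open>Complete bipartite graphs, possibly with one extra edge\<close>

definition bipartite_edges :: "nat \<Rightarrow> nat \<Rightarrow> nat set set" where
  "bipartite_edges k n = (\<lambda>(a, b). {a, b}) ` ({..<k} \<times> {k..<n})"

lemma in_bipartite_edges:
  "{u, v} \<in> bipartite_edges k n \<longleftrightarrow> u < k \<and> k \<le> v \<and> v < n \<or> v < k \<and> k \<le> u \<and> u < n"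
  by (auto simp: bipartite_edges_def doubleton_eq_iff image_iff)

lemma card_bipartite_edges: "card (bipartite_edges k n) = k * (n - k)"
proof -
  have "inj_on (\<lambda>(a, b). {a, b}) ({..<k} \<times> {k..<n})"
    by (auto simp: inj_on_def doubleton_eq_iff)
  then show ?thesis by (simp add: bipartite_edges_def card_image)
qed

lemma bipartite_edges_meet: "e \<in> bipartite_edges k n \<Longrightarrow> e \<inter> {..<k} \<noteq> {}"
  by (auto simp: bipartite_edges_def)

lemma wf_bipartite:
  assumes "k \<le> n"
  shows "wf_graph ({0..<n}, bipartite_edges k n)"
proof -
  have "\<exists>u v. u \<noteq> v \<and> u \<in> {0..<n} \<and> v \<in> {0..<n} \<and> e = {u, v}" if e: "e \<in> bipartite_edges k n" for e
  proof -
    obtain a b where "e = {a, b}" "a < k" "k \<le> b" "b < n"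
      using e by (auto simp: bipartite_edges_def)
    then show ?thesis using assms by (intro exI[of _ a] exI[of _ b]) auto
  qed
  then show ?thesis by (simp add: wf_graph_def verts_def edges_def)
qed

lemma wf_bipartite_plus:
  assumes "k + 2 \<le> n"
  shows "wf_graph ({0..<n}, insert {k, k + 1} (bipartite_edges k n))"
proof -
  have "wf_graph ({0..<n}, bipartite_edges k n)" using assms by (intro wf_bipartite) simp
  moreover have "\<exists>u v. u \<noteq> v \<and> u \<in> {0..<n} \<and> v \<in> {0..<n} \<and> {k, k + 1} = {u, v}"
    using assms by (intro exI[of _ k] exI[of _ "k + 1"]) auto
  ultimately show ?thesis by (simp add: wf_graph_def verts_def edges_def)
qed

lemma bipartite_forest_free:
  assumes "halves ms = k + 1"
  shows "\<not> contains ({0..<n}, bipartite_edges k n) (path_forest ms)"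
proof
  assume "contains ({0..<n}, bipartite_edges k n) (path_forest ms)"
  then have "has_forest (bipartite_edges k n) {0..<n} ms"
    by (simp add: contains_path_forest verts_def edges_def)
  then have "halves ms \<le> card ({..<k} \<inter> {0..<n})"
    using path_cover[OF _ bipartite_edges_meet] by (intro forest_cover) auto
  also have "\<dots> \<le> card {..<k}" by (intro card_mono) auto
  finally show False using assms by simp
qed

lemma bipartite_plus_forest_free:
  assumes "halves ms = k + 1" "\<forall>m\<in>set ms. odd m"
  shows "\<not> contains ({0..<n}, insert {k, k + 1} (bipartite_edges k n)) (path_forest ms)"
proof
  assume "contains ({0..<n}, insert {k, k + 1} (bipartite_edges k n)) (path_forest ms)"
  then have "has_forest (insert {k, k + 1} (bipartite_edges k n)) {0..<n} ms"
    by (simp add: contains_path_forest verts_def edges_def)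
  then have "halves ms \<le> card ({..<k} \<inter> {0..<n})"
    using path_cover_odd[OF _ _ bipartite_edges_meet] assms(2) by (intro forest_cover) auto
  also have "\<dots> \<le> card {..<k}" by (intro card_mono) auto
  finally show False using assms(1) by simp
qed

lemma bipartite_not_contains:
  assumes "\<not> colorable F 2"
  shows "\<not> contains ({0..<n}, bipartite_edges k n) F"
proof
  assume "contains ({0..<n}, bipartite_edges k n) F"
  then obtain f where f: "\<And>e. e \<in> edges F \<Longrightarrow> f ` e \<in> bipartite_edges k n"
    unfolding contains_def by (auto simp: edges_def)
  define col where "col v = (if f v < k then 0 else 1 :: nat)" for v
  have "col u \<noteq> col v" if "{u, v} \<in> edges F" for u v
    using f[OF that] by (auto simp: in_bipartite_edges col_def)
  then have "colorable F 2" unfolding colorable_def by (intro exI[of _ col]) (auto simp: col_def)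
  with assms show False by simp
qed

context controlled_graph
begin

text \<open>If \<open>u1\<close> lies in the small part, then \<open>u2\<close> and every common
  neighbour lie in the large part and must be the two ends of the extra edge; so there is just one
  triangle. All other neighbours of \<open>u2\<close> lie among the \<open>k\<close> small vertices,
  so its degree is at most \<open>k + 1\<close>.\<close>

lemma bipartite_plus_apex:
  assumes f: "inj_on f (verts F)"
    "\<And>e. e \<in> edges F \<Longrightarrow> f ` e \<in> insert {k, k + 1} (bipartite_edges k n)"
    and apex: "f u1 < k"
  shows "num_triangles F = 1 \<and> f_val F \<le> k + 1"
proof -
  have adj: "f u < k \<and> k \<le> f v \<or> f v < k \<and> k \<le> f u \<or> {f u, f v} = {k, k + 1}"
    if "{u, v} \<in> edges F" for u v
    using f(2)[OF that] by (auto simp: in_bipartite_edges)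
  obtain w where w: "{u1, w} \<in> edges F" "{u2, w} \<in> edges F" using common_neighbour by blast
  have ge: "k \<le> f v" if "{u1, v} \<in> edges F" for v
    using adj[OF that] apex by (auto simp: doubleton_eq_iff)
  have pair: "{f u2, f v} = {k, k + 1}" if "{u1, v} \<in> edges F" "{u2, v} \<in> edges F" for v
    using adj[OF that(2)] ge[OF that(1)] ge[OF base_edge] by auto
  have "v = w" if "{u1, v} \<in> edges F" "{u2, v} \<in> edges F" for v
  proof -
    have "f v = f w" using pair[OF that] pair[OF w] by (auto simp: doubleton_eq_iff)
    then show ?thesis using inj_onD[OF f(1)] wf_graph_edge[OF wf that(1)] wf_graph_edge[OF wf w(1)] by blast
  qed
  then have "{v. {u1, v} \<in> edges F \<and> {u2, v} \<in> edges F} = {w}" using w by blast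
  then have "num_triangles F = 1" by (simp add: num_triangles_eq)
  have fin: "finite (nbrs (edges F) (verts F) u2)" using wf_graph_finite[OF wf] by simp
  have "f ` nbrs (edges F) (verts F) u2 \<subseteq> insert (f w) {..<k}"
  proof
    fix z assume "z \<in> f ` nbrs (edges F) (verts F) u2"
    then obtain v where v: "{u2, v} \<in> edges F" "z = f v" by (auto simp: nbrs_def)
    show "z \<in> insert (f w) {..<k}"
      using adj[OF v(1)] ge[OF base_edge] pair[OF w] v(2) by (auto simp: doubleton_eq_iff)
  qed
  then have "card (f ` nbrs (edges F) (verts F) u2) \<le> card (insert (f w) {..<k})"
    by (intro card_mono) auto
  also have "\<dots> \<le> k + 1" by (simp add: card_insert_if)
  also have "card (f ` nbrs (edges F) (verts F) u2) = degree F u2"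
    unfolding degree_eq_card_nbrs[OF wf] using f(1) nbrs_subset
    by (intro card_image) (rule inj_on_subset)
  finally have "min (degree F u1) (degree F u2) \<le> k + 1" by simp
  moreover have "f_val F \<le> min (degree F u1) (degree F u2)"
    unfolding f_val_def using f_val_set_finite[OF wf] u12 control by (intro Min_le) blast+
  ultimately show ?thesis using \<open>num_triangles F = 1\<close> by (meson order_trans)
qed

text \<open>When neither end of the control edge lies in the small part, that edge is the extra
  edge, and every other vertex, being adjacent to one of its ends, is among the \<open>k\<close>
  small ones.\<close>

lemma bipartite_plus_contains:
  assumes "contains ({0..<n}, insert {k, k + 1} (bipartite_edges k n)) F"
  shows "card (verts F) \<le> k + 2 \<or> num_triangles F = 1 \<and> f_val F \<le> k + 1"
proof -
  obtain f where f: "inj_on f (verts F)"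
    "\<And>e. e \<in> edges F \<Longrightarrow> f ` e \<in> insert {k, k + 1} (bipartite_edges k n)"
    using assms unfolding contains_def by (auto simp: edges_def)
  interpret sw: controlled_graph F u2 u1 by (rule swap)
  consider "f u1 < k" | "f u2 < k" | "k \<le> f u1" "k \<le> f u2" by linarith
  then show ?thesis
  proof cases
    case 1
    then show ?thesis using bipartite_plus_apex[OF f] by blast
  next
    case 2
    then show ?thesis using sw.bipartite_plus_apex[OF f] by blast
  next
    case 3
    have adj: "f u < k \<and> k \<le> f v \<or> f v < k \<and> k \<le> f u \<or> {f u, f v} = {k, k + 1}"
      if "{u, v} \<in> edges F" for u v
      using f(2)[OF that] by (auto simp: in_bipartite_edges)
    have pair: "{f u1, f u2} = {k, k + 1}" using adj[OF base_edge] 3 by linarith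
    have "f v < k" if v: "v \<in> verts F - {u1, u2}" for v
    proof -
      have ne: "f v \<noteq> f u1" "f v \<noteq> f u2" using inj_onD[OF f(1)] v u_verts by auto
      then have "{f u1, f v} \<noteq> {k, k + 1}" "{f u2, f v} \<noteq> {k, k + 1}"
        using pair by (auto simp: doubleton_eq_iff)
      then show ?thesis using other_adjacent[of v] v adj[of u1 v] adj[of u2 v] 3 by auto
    qed
    then have "f ` (verts F - {u1, u2}) \<subseteq> {..<k}" by auto
    then have "card (f ` (verts F - {u1, u2})) \<le> k" using card_mono[of "{..<k}"] by fastforce
    moreover have "card (f ` (verts F - {u1, u2})) = card (verts F - {u1, u2})"
      using f(1) by (intro card_image) (rule inj_on_subset, auto)
    ultimately show ?thesis using card_rest by simp
  qed
qed

end

section \<open>The exact value of the extremal number\<close>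

lemma ex_eqI:
  assumes "wf_graph G" "verts G = {0..<n}" "\<And>F. F \<in> Fs \<Longrightarrow> \<not> contains G F" "card (edges G) = c"
    and "\<And>G. wf_graph G \<Longrightarrow> verts G = {0..<n} \<Longrightarrow> (\<And>F. F \<in> Fs \<Longrightarrow> \<not> contains G F)
           \<Longrightarrow> card (edges G) \<le> c"
  shows "ex n Fs = c"
  unfolding ex_def
proof (rule Max_eqI)
  show "finite {card (edges G) | G. wf_graph G \<and> verts G = {0..<n} \<and> (\<forall>F\<in>Fs. \<not> contains G F)}"
    by (rule finite_subset[of _ "{..c}"]) (use assms(5) in auto)
  show "c \<in> {card (edges G) | G. wf_graph G \<and> verts G = {0..<n} \<and> (\<forall>F\<in>Fs. \<not> contains G F)}"
    using assms(1-4) by blast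
qed (use assms(5) in blast)

text \<open>Here \<open>k\<close> is the size of the core, one less than l, so the thresholds
  \<open>k + 2\<close> and \<open>k + 1\<close> are the l + 1 and l of property R.\<close>

lemma forest_control_edge_bound:
  assumes len: "length ms \<ge> 2" and ge3: "\<forall>m\<in>set ms. m \<ge> 3" and ge4: "\<exists>m\<in>set ms. m \<ge> 4"
    and F: "wf_graph F" "no_isolated F" "chromatic_number F \<ge> 3" "beta1 F = 1"
    and k: "halves ms = k + 1"
  shows "\<exists>N. \<forall>n\<ge>N. \<forall>G. wf_graph G \<longrightarrow> verts G = {0..<n} \<longrightarrow>
     \<not> contains G (path_forest ms) \<longrightarrow> \<not> contains G F \<longrightarrow>
     card (edges G) \<le> k * (n - k) \<or>
     (card (edges G) \<le> k * (n - k) + 1 \<and> (\<forall>m\<in>set ms. odd m) \<and> \<not> card (verts F) \<le> k + 2 \<and>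
      \<not> (num_triangles F = 1 \<and> f_val F \<le> k + 1))"
proof -
  define m0 where "m0 = Min (set ms)"
  have ne: "ms \<noteq> []" using len by auto
  then have m0: "m0 \<in> set ms" "\<forall>m\<in>set ms. m0 \<le> m" by (auto simp: m0_def)
  then obtain as bs where ms: "ms = as @ m0 # bs" by (meson split_list)
  define rest where "rest = as @ bs"
  have rest: "rest \<noteq> []" "\<forall>m\<in>set rest. m0 \<le> m" using len m0(2) by (auto simp: rest_def ms)
  have m03: "m0 \<ge> 3" using ge3 m0 by auto
  then have m02: "m0 \<ge> 2" by simp
  have hl: "halves (m0 # rest) = k + 1" using k by (simp add: ms rest_def)
  have half: "2 * (m0 div 2) \<le> halves ms"
  proof -
    obtain m r where r: "rest = m # r" using rest(1) by (cases rest) auto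
    then have "m0 div 2 \<le> m div 2" using rest(2) by (intro div_le_mono) auto
    then show ?thesis using hl k r by simp
  qed
  obtain m1 where m1: "m1 \<in> set ms" "m1 \<ge> 4" using ge4 by auto
  have even4: "\<forall>m\<in>set ms. even m \<longrightarrow> m \<ge> 4"
  proof (intro ballI impI)
    fix m assume "m \<in> set ms" "even m"
    then have "m \<ge> 3" "m \<noteq> 3" using ge3 by auto
    then show "m \<ge> 4" by simp
  qed
  \<comment> \<open>Large enough for the exact bound around the core and for both embeddings that
    use \<open>W\<close>, the larger of which needs \<open>card (verts F) + 2\<close>.\<close>
  define M where "M = sum_list ms + 5 + card (verts F)"
  \<comment> \<open>A graph with more than \<open>k * (n - k)\<close> edges falls short of
    \<open>k * n\<close> by less than \<open>k * k\<close>; the doubled deficit is the gap.\<close>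
  obtain N where N: "\<And>(E :: nat set set) X. sgraph E \<Longrightarrow> finite X \<Longrightarrow> N \<le> card X \<Longrightarrow>
     \<not> has_forest E X (m0 # rest) \<Longrightarrow>
     2 * ((k + 1) * card X) \<le> 2 * esize E X + 2 * card X + 2 * (k * k) \<Longrightarrow>
     \<exists>A W. A \<subseteq> X \<and> W \<subseteq> X \<and> joined E A W \<and> card A + 1 = k + 1 \<and> M \<le> card W"
    using dense_forest_free_joined[OF rest(1) m02 rest(2), where gap = "2 * (k * k)" and M = M and 'a = nat]
    unfolding hl by blast
  have "card (edges G) \<le> k * (n - k) \<or>
     (card (edges G) \<le> k * (n - k) + 1 \<and> (\<forall>m\<in>set ms. odd m) \<and> \<not> card (verts F) \<le> k + 2 \<and>
      \<not> (num_triangles F = 1 \<and> f_val F \<le> k + 1))"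
    if n: "N + k \<le> n" and G: "wf_graph G" "verts G = {0..<n}" "\<not> contains G (path_forest ms)"
      "\<not> contains G F" for n G
  proof (cases "card (edges G) \<le> k * (n - k)")
    case False
    define E X where "E = edges G" and "X = verts G"
    interpret sgraph E using wf_graph_sgraph[OF G(1)] by (simp add: E_def)
    have X: "finite X" "card X = n" "card (edges G) = esize E X"
      using G card_edges by (auto simp: X_def E_def)
    have no: "\<not> has_forest E X ms" using G(3) by (simp add: contains_path_forest E_def X_def)
    then have no': "\<not> has_forest E X (m0 # rest)"
      unfolding ms rest_def using has_forest_front by blast
    have "k * n = k * (n - k) + k * k" using n by (simp add: distrib_left[symmetric])
    then have "2 * ((k + 1) * card X) \<le> 2 * esize E X + 2 * card X + 2 * (k * k)"
      using False X(2,3) by (simp add: distrib_right)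
    then obtain A W where AW: "A \<subseteq> X" "W \<subseteq> X" "joined E A W" "card A = k" "M \<le> card W"
      using N[OF sgraph_axioms X(1) _ no'] n X(2) by auto
    have fA: "finite A" using AW(1) X(1) finite_subset by blast
    obtain u1 u2 where cg: "controlled_graph F u1 u2" "f_val F = degree F u2"
      using f_val_attained[OF F] .
    interpret controlled_graph F u1 u2 by (rule cg)
    have indep: "{a, b} \<notin> E" if "a \<in> A" "b \<in> A" for a b
    proof
      assume "{a, b} \<in> E"
      moreover have "joined E {a, b} W" using AW(3) that by (intro joined_mono[OF AW(3)]) auto
      ultimately have "contains G F"
        using AW(2,5) G(1) by (intro embed_book[of G a b W]) (auto simp: E_def X_def M_def)
      then show False using G(4) by simp
    qed
    have "card (X - A) = n - k" using AW(1,4) fA X(2) by (simp add: card_Diff_subset)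
    then have "esize E X \<le> k * (n - k) + 1" "\<forall>m\<in>set ms. odd m"
      and "\<exists>x\<in>X - A. \<exists>y\<in>X - A. {x, y} \<in> E \<and> (\<forall>a\<in>A. {x, a} \<in> E \<and> {y, a} \<in> E)"
      using joined_edge_bound[OF sgraph_axioms X(1) no m0(1) _ half m1 even4 AW(1-3) _ _ indep]
        AW(4,5) k m03 False X(3) unfolding M_def by auto
    then obtain x y where xy: "x \<in> X - A" "y \<in> X - A" "{x, y} \<in> E"
      "\<forall>a\<in>A. {x, a} \<in> E \<and> {y, a} \<in> E" by blast
    have J: "joined E {x, y} A" using xy by (auto simp: joined_def)
    have "\<not> card (verts F) \<le> k + 2"
    proof
      assume "card (verts F) \<le> k + 2"
      then have "contains G F"
        using embed_small[OF G(1), of x y A] xy(3) J AW(1,4) by (simp add: E_def X_def)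
      then show False using G(4) by simp
    qed
    moreover have "\<not> (num_triangles F = 1 \<and> f_val F \<le> k + 1)"
    proof
      assume t: "num_triangles F = 1 \<and> f_val F \<le> k + 1"
      have "m0 div 2 \<ge> 1" using m03 by simp
      then have "A \<noteq> {}" using half k AW(4) by auto
      then have "contains G F"
        using embed_unique_triangle[OF G(1), of x y A W] xy(3) J AW t cg(2)
        by (simp add: E_def X_def M_def)
      then show False using G(4) by simp
    qed
    ultimately show ?thesis using \<open>esize E X \<le> k * (n - k) + 1\<close> \<open>\<forall>m\<in>set ms. odd m\<close> X(3) by simp
  qed simp
  then show ?thesis by blast
qed

theorem theorem1p12:
  fixes k :: nat and l :: "nat \<Rightarrow> nat" and I1 :: "nat set" and F :: ugraph
  assumes k2: "k \<ge> 2"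
    and I1_sub: "I1 \<subseteq> {0..<k}"
    and even_len: "\<forall>i\<in>I1. l i \<ge> 2"
    and odd_len: "\<forall>j\<in>{0..<k} - I1. l j \<ge> 1"
    and not_kP3: "\<not> (I1 = {} \<and> (\<forall>j<k. l j = 1))"
    and F_wf: "wf_graph F"
    and F_noiso: "no_isolated F"
    and F_chi: "chromatic_number F \<ge> 3"
    and F_beta: "beta1 F = 1"
  shows "\<exists>N. \<forall>n\<ge>N.
     (let H = path_forest (map (\<lambda>i. if i \<in> I1 then 2 * l i else 2 * l i + 1) [0..<k]);
          L = (\<Sum>i<k. l i);
          R = (I1 \<noteq> {} \<or> card (verts F) \<le> L + 1 \<or>
               (num_triangles F = 1 \<and> f_val F \<le> L));
          D = (if R then 0 else 1)
      in int (ex n {H, F}) = (int L - 1) * (int n - int L + 1) + D)"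
proof -
  define ms where "ms = map (\<lambda>i. if i \<in> I1 then 2 * l i else 2 * l i + 1) [0..<k]"
  define L where "L = (\<Sum>i<k. l i)"
  define R where "R \<longleftrightarrow> I1 \<noteq> {} \<or> card (verts F) \<le> L + 1 \<or> (num_triangles F = 1 \<and> f_val F \<le> L)"
  define r where "r = L - 1"
  have l1: "l i \<ge> 1" if "i < k" for i using even_len odd_len that by (cases "i \<in> I1") auto
  have "L \<ge> (\<Sum>i<k. 1)" unfolding L_def using l1 by (intro sum_mono) auto
  then have L2: "L = r + 1" using k2 by (simp add: r_def)
  have set_ms: "set ms = (\<lambda>i. if i \<in> I1 then 2 * l i else 2 * l i + 1) ` {..<k}"
    by (auto simp: ms_def)
  have halves_ms: "halves ms = r + 1"
  proof -
    have "halves ms = (\<Sum>i\<leftarrow>[0..<k]. l i)"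
      unfolding halves_def ms_def map_map by (rule arg_cong[where f = sum_list]) auto
    then show ?thesis using L2 by (simp add: L_def interv_sum_list_conv_sum_set_nat atLeast0LessThan)
  qed
  have ge3: "\<forall>m\<in>set ms. m \<ge> 3" using l1 even_len by (fastforce simp: set_ms)
  have ge4: "\<exists>m\<in>set ms. m \<ge> 4"
  proof (cases "I1 = {}")
    case True
    then obtain j where j: "j < k" "l j \<noteq> 1" using not_kP3 by auto
    then have "2 * l j + 1 \<ge> 4" using l1[of j] by simp
    then show ?thesis using True j by (auto simp: set_ms)
  next
    case False
    then obtain i where i: "i \<in> I1" by auto
    then have "2 * l i \<ge> 4" "i < k" using even_len I1_sub by force+
    moreover have "2 * l i \<in> set ms" using i \<open>i < k\<close> by (auto simp: set_ms)
    ultimately show ?thesis by blast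
  qed
  have len: "length ms \<ge> 2" using k2 by (simp add: ms_def)
  have odd_iff: "(\<forall>m\<in>set ms. odd m) \<longleftrightarrow> I1 = {}"
  proof
    assume odd: "\<forall>m\<in>set ms. odd m"
    have "i \<notin> I1" for i
    proof
      assume i: "i \<in> I1"
      then have "i < k" using I1_sub by auto
      then have "2 * l i \<in> set ms" using i unfolding set_ms by (intro image_eqI[of _ _ i]) auto
      then have "odd (2 * l i)" using odd by blast
      then show False by simp
    qed
    then show "I1 = {}" by blast
  qed (auto simp: set_ms)
  from forest_control_edge_bound[OF len ge3 ge4 F_wf F_noiso F_chi F_beta halves_ms]
  obtain N where N: "\<forall>n\<ge>N. \<forall>G. wf_graph G \<longrightarrow> verts G = {0..<n} \<longrightarrow>
     \<not> contains G (path_forest ms) \<longrightarrow> \<not> contains G F \<longrightarrow>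
     card (edges G) \<le> r * (n - r) \<or>
     (card (edges G) \<le> r * (n - r) + 1 \<and> (\<forall>m\<in>set ms. odd m) \<and> \<not> card (verts F) \<le> r + 2 \<and>
      \<not> (num_triangles F = 1 \<and> f_val F \<le> r + 1))" ..
  obtain u1 u2 where "u1 \<noteq> u2" "edge_control_set F {{u1, u2}}"
    using beta1_one_edge[OF F_beta F_wf] .
  then interpret controlled_graph F u1 u2
    using F_wf F_noiso F_chi by unfold_locales
  \<comment> \<open>\<open>r + 2 \<le> n\<close> leaves room for the small part and the extra edge,
    and makes \<open>n - r\<close> a genuine subtraction, so that the count can later be moved to
    the integers.\<close>
  have "ex n {path_forest ms, F} = r * (n - r) + (if R then 0 else 1)" if n: "N + r + 2 \<le> n" for n
  proof (cases R)
    case True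
    show ?thesis
    proof (rule ex_eqI[of "({0..<n}, bipartite_edges r n)"])
      show "wf_graph ({0..<n}, bipartite_edges r n)" using n by (intro wf_bipartite) simp
      show "\<not> contains ({0..<n}, bipartite_edges r n) F'" if "F' \<in> {path_forest ms, F}" for F'
        using that bipartite_forest_free[OF halves_ms] bipartite_not_contains not_2_colorable[OF F_chi]
        by blast
      show "card (edges G) \<le> r * (n - r) + (if R then 0 else 1)"
        if "wf_graph G" "verts G = {0..<n}" "\<And>F'. F' \<in> {path_forest ms, F} \<Longrightarrow> \<not> contains G F'" for G
        using N[rule_format, of n G] n that True odd_iff L2 unfolding R_def by auto
    qed (use True in \<open>auto simp: verts_def edges_def card_bipartite_edges\<close>)
  next
    case False
    let ?E = "insert {r, r + 1} (bipartite_edges r n)"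
    show ?thesis
    proof (rule ex_eqI[of "({0..<n}, ?E)"])
      show "wf_graph ({0..<n}, ?E)" using n by (intro wf_bipartite_plus) simp
      show "\<not> contains ({0..<n}, ?E) F'" if "F' \<in> {path_forest ms, F}" for F'
        using that bipartite_plus_forest_free[OF halves_ms] bipartite_plus_contains[of n r] False odd_iff L2
        unfolding R_def by auto
      have "finite (bipartite_edges r n)" by (simp add: bipartite_edges_def)
      moreover have "{r, r + 1} \<notin> bipartite_edges r n" by (simp add: in_bipartite_edges)
      ultimately show "card (edges ({0..<n}, ?E)) = r * (n - r) + (if R then 0 else 1)"
        using False by (simp add: edges_def card_bipartite_edges)
      show "card (edges G) \<le> r * (n - r) + (if R then 0 else 1)"
        if "wf_graph G" "verts G = {0..<n}" "\<And>F'. F' \<in> {path_forest ms, F} \<Longrightarrow> \<not> contains G F'" for G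
        using N[rule_format, of n G] n that False by auto
    qed (simp add: verts_def)
  qed
  then have "int (ex n {path_forest ms, F}) = (int L - 1) * (int n - int L + 1) + (if R then 0 else 1)"
    if "N + r + 2 \<le> n" for n
    using that L2 by (simp add: of_nat_diff)
  then show ?thesis
    unfolding Let_def ms_def[symmetric] L_def[symmetric] R_def[symmetric] by blast
qed

end
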